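(* Let $V$ be $\mathbb R^n$, $\mathbb C^n$ or $\mathbb H^n$. On the Stiefel manifold $\mathrm{St}_k^n(V)$ consider the homogeneous metrics induced by (i) the sub-Riemannian metric on $G_n$ relative to the reduced horizontal distribution, (ii) the sub-Riemannian metric on $G_n\times G_k$ relative to the quasi-geodesic horizontal distribution, and (iii) the sub-Riemannian metric on $G_n\times G_k$ relative to the orthogonal horizontal distribution. Then the homogeneous metrics (i) and (ii) on $\mathrm{St}_k^n(V)$ are equal, and they are different from the homogeneous metric (iii).
   Context: $G_n$ denotes $\mathrm{SO}(n)$, $\mathrm{SU}(n)$, $\mathrm{Sp}(n)$ for $V=\mathbb R^n,\mathbb C^n,\mathbb H^n$ respectively (with $\mathrm{Sp}(n)$ the quaternionic $n\times n$ matrices $\Theta$ with $\Theta^*\Theta=\Theta\Theta^*=I_n$), and $\mathfrak g_n$ its Lie algebra; ${}^*$ is the transpose, complex conjugate transpose, or quaternionic conjugate transpose. $\mathrm{St}_k^n(V)$ is the set of ordered $k$-tuples of orthonormal vectors in $V$, identified with the $n\times k$ matrices $m$ over $\mathbb R$, $\mathbb C$ or $\mathbb H$ with $m^*m=I_k$, and $I_{nk}=\begin{pmatrix}I_k\\0\end{pmatrix}$. The trace form is $\langle A,B\rangle=-\frac12\mathrm{Tr}(AB)$ on $\mathfrak g_n$ in the real and complex cases, and $\langle A,B\rangle=-\frac14\mathrm{Tr}(AB+(AB)^* )$ on $\mathfrak{sp}(n)$; on a product of two such Lie algebras it is the sum of the trace forms of the factors. Reduced case: $G=G_n$ acts on $\mathrm{St}_k^n(V)$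 by $(g,m)\mapsto gm$; $\pi(g)=gI_{nk}$; the isotropy algebra of $I_{nk}$ is $\mathfrak k=\{\begin{pmatrix}0&0\\0&D\end{pmatrix}: D\in\mathfrak g_{n-k}\}$; the reduced distribution is given by $\mathfrak p=\{\begin{pmatrix}A&B\\-B^*&0\end{pmatrix}:A\in\mathfrak g_k\}$ ($B$ a $k\times(n-k)$ matrix). Full action: $G=G_n\times G_k$ acts by $((r,s),m)\mapsto rms^{-1}$; $\pi(r,s)=rI_{nk}s^{-1}$; the isotropy algebra of $I_{nk}$ is $\mathfrak k=\{(\begin{pmatrix}C&0\\0&D\end{pmatrix},C):C\in\mathfrak g_k,D\in\mathfrak g_{n-k}\}$. The orthogonal distribution is given by $\mathfrak p=\{(\begin{pmatrix}A&B\\-B^*&0\end{pmatrix},-A):A\in\mathfrak g_k\}$, and the quasi-geodesic distribution by $\mathfrak p=\{(\begin{pmatrix}0&B\\-B^*&0\end{pmatrix},A):A\in\mathfrak g_k\}$. In each case the horizontal distribution is $\mathcal H_{\mathfrak p}(g)=\{gX:X\in\mathfrak p\}$, $g\in G$, with the left-invariant sub-Riemannian metric $\langle gX,gY\rangle=\langle X,Y\rangle$ obtained by restricting the trace form to $\mathfrak p$. The induced homogeneous metric on $\mathrm{St}_k^n(V)$ is the push-forward of the sub-Riemannian metric: the length of a curve $m(t)$ in $\mathrm{St}_k^n(V)$ is the length of a horizontal lift, i.e. of a curve $g(t)$ in $G$ with $\dot g(t)\in\mathcal H_{\mathfrak p}(g(t))$ and $\pi(g(t))=m(t)$.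
   Formalization: For V real or complex, the claim that (i) and (ii) differ from (iii) is stated only for k ≥ 2: when k = 1 the Lie algebras so(1) and su(1) vanish, so all three metrics coincide and the claim fails. The equality of (i) and (ii) is kept for all 1 ≤ k ≤ n. *)

theory Defs
  imports "HOL-Analysis.Henstock_Kurzweil_Integration" "Jordan_Normal_Form.Determinant"
begin

section \<open>Quaternions\<close>

datatype quat = Quat (qre: real) (qim1: real) (qim2: real) (qim3: real)

lemma quat_eqI:
  "qre x = qre y \<Longrightarrow> qim1 x = qim1 y \<Longrightarrow> qim2 x = qim2 y \<Longrightarrow> qim3 x = qim3 y \<Longrightarrow> x = y"
  by (cases x; cases y) simp

instantiation quat :: ring_1
begin

definition "0 = Quat 0 0 0 0"
definition "1 = Quat 1 0 0 0"
definition "x + y = Quat (qre x + qre y) (qim1 x + qim1 y) (qim2 x + qim2 y) (qim3 x + qim3 y)"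
definition "- x = Quat (- qre x) (- qim1 x) (- qim2 x) (- qim3 x)"
definition "x - y = Quat (qre x - qre y) (qim1 x - qim1 y) (qim2 x - qim2 y) (qim3 x - qim3 y)"
definition "x * y = Quat
  (qre x * qre y - qim1 x * qim1 y - qim2 x * qim2 y - qim3 x * qim3 y)
  (qre x * qim1 y + qim1 x * qre y + qim2 x * qim3 y - qim3 x * qim2 y)
  (qre x * qim2 y - qim1 x * qim3 y + qim2 x * qre y + qim3 x * qim1 y)
  (qre x * qim3 y + qim1 x * qim2 y - qim2 x * qim1 y + qim3 x * qre y)"

lemmas quat_ring_defs =
  zero_quat_def one_quat_def plus_quat_def uminus_quat_def minus_quat_def times_quat_def

instance
  by standard (auto simp: quat_ring_defs algebra_simps quat.expand)

end

instantiation quat :: real_normed_algebra_1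
begin

definition "r *\<^sub>R x = Quat (r * qre x) (r * qim1 x) (r * qim2 x) (r * qim3 x)"
definition "norm x = norm (Complex (qre x) (qim1 x), Complex (qim2 x) (qim3 x))"
definition "sgn x = inverse (norm x) *\<^sub>R (x :: quat)"
definition "dist x y = norm (x - y :: quat)"
definition "(uniformity :: (quat \<times> quat) filter) =
  (INF e\<in>{0 <..}. principal {(x, y). dist x y < e})"
definition "open (U :: quat set) \<longleftrightarrow>
  (\<forall>x\<in>U. \<forall>\<^sub>F (x', y) in uniformity. x' = x \<longrightarrow> y \<in> U)"

lemma norm_quat_sqrt: "norm x = sqrt ((qre x)\<^sup>2 + (qim1 x)\<^sup>2 + (qim2 x)\<^sup>2 + (qim3 x)\<^sup>2)"
  by (simp add: norm_quat_def norm_Pair cmod_def add.assoc)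

instance
proof
  fix x y :: quat and r s :: real
  show "norm (x + y) \<le> norm x + norm y"
    using norm_triangle_ineq[of "(Complex (qre x) (qim1 x), Complex (qim2 x) (qim3 x))"
        "(Complex (qre y) (qim1 y), Complex (qim2 y) (qim3 y))"]
    by (simp add: norm_quat_def plus_quat_def complex_add)
  show "norm (r *\<^sub>R x) = \<bar>r\<bar> * norm x"
    by (simp add: norm_quat_sqrt scaleR_quat_def power_mult_distrib real_sqrt_mult
        flip: distrib_left)
  show "norm x = 0 \<longleftrightarrow> x = 0"
    by (cases x) (simp add: norm_quat_def zero_quat_def zero_prod_def complex_eq_iff)
  show "norm (x * y) \<le> norm x * norm y"
    unfolding norm_quat_sqrt real_sqrt_mult[symmetric] times_quat_def
    by (rule real_sqrt_le_mono) (simp add: power2_eq_square algebra_simps)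
  show "norm (1 :: quat) = 1"
    by (simp add: norm_quat_sqrt one_quat_def)
  show "dist x y = norm (x - y)" by (fact dist_quat_def)
  show "sgn x = inverse (norm x) *\<^sub>R x" by (fact sgn_quat_def)
  show "uniformity = (INF e\<in>{0 <..}. principal {(x :: quat, y). dist x y < e})"
    by (fact uniformity_quat_def)
  show "open U \<longleftrightarrow> (\<forall>x\<in>U. \<forall>\<^sub>F (x', y) in uniformity. x' = x \<longrightarrow> y \<in> U)" for U :: "quat set"
    by (fact open_quat_def)
qed (simp_all add: scaleR_quat_def plus_quat_def times_quat_def algebra_simps)

end


section \<open>Classical groups, their Lie algebras and trace forms\<close>

definition tr :: "'a :: comm_monoid_add mat \<Rightarrow> 'a" where
  "tr A = (\<Sum>i<dim_row A. A $$ (i, i))"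

class star_ring = ring_1 +
  fixes star :: "'a \<Rightarrow> 'a"
  assumes star_star [simp]: "star (star x) = x"
    and star_add: "star (x + y) = star x + star y"
    and star_mult: "star (x * y) = star y * star x"

instantiation real :: star_ring
begin

definition "star (x :: real) = x"

instance
  by standard (simp_all add: star_real_def)

end

instantiation complex :: star_ring
begin

definition "star x = cnj x"

instance
  by standard (simp_all add: star_complex_def)

end

instantiation quat :: star_ring
begin

definition "star x = Quat (qre x) (- qim1 x) (- qim2 x) (- qim3 x)"

instance
  by standard (simp_all add: star_quat_def plus_quat_def times_quat_def)

end

definition adj :: "'a :: star_ring mat \<Rightarrow> 'a mat" where
  "adj A = mat (dim_col A) (dim_row A) (\<lambda>(i, j). star (A $$ (j, i)))"

definition unitary_mats :: "nat \<Rightarrow> 'a :: star_ring mat set" where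
  "unitary_mats n = {A \<in> carrier_mat n n. adj A * A = 1\<^sub>m n \<and> A * adj A = 1\<^sub>m n}"

definition skew_mats :: "nat \<Rightarrow> 'a :: star_ring mat set" where
  "skew_mats n = {A \<in> carrier_mat n n. adj A = - A}"

text \<open>The three cases share one notation: \<open>grp n\<close> is the group $G_n$, \<open>lie n\<close> its Lie algebra
  and \<open>form\<close> the trace form on \<open>lie n\<close>.\<close>

class classical_scalar = real_normed_algebra_1 + star_ring +
  fixes grp :: "nat \<Rightarrow> 'a mat set"
    and lie :: "nat \<Rightarrow> 'a mat set"
    and form :: "'a mat \<Rightarrow> 'a mat \<Rightarrow> real"

instantiation real :: classical_scalar
begin

definition "grp n = {A :: real mat. A \<in> unitary_mats n \<and> det A = 1}"
definition "lie n = (skew_mats n :: real mat set)"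
definition "form A B = - (1 / 2) * tr (A * B :: real mat)"

instance ..

end

instantiation complex :: classical_scalar
begin

definition "grp n = {A :: complex mat. A \<in> unitary_mats n \<and> det A = 1}"
definition "lie n = {A :: complex mat. A \<in> skew_mats n \<and> tr A = 0}"

text \<open>For skew-Hermitian \<open>A\<close> and \<open>B\<close> the trace of \<open>A * B\<close> is real, so \<open>Re\<close> only adjusts the type.
  The same applies to \<open>qre\<close> below, where \<open>A * B + adj (A * B)\<close> is self-adjoint.\<close>

definition "form A B = Re (- (1 / 2) * tr (A * B :: complex mat))"

instance ..

end

instantiation quat :: classical_scalar
begin

definition "grp n = (unitary_mats n :: quat mat set)"
definition "lie n = (skew_mats n :: quat mat set)"
definition "form A B = - (1 / 4) * qre (tr (A * B + adj (A * B)))"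

instance ..

end


section \<open>Stiefel manifolds and horizontal distributions\<close>

definition stiefel :: "nat \<Rightarrow> nat \<Rightarrow> 'a :: classical_scalar mat set" where
  "stiefel n k = {m \<in> carrier_mat n k. adj m * m = 1\<^sub>m k}"

definition base_point :: "nat \<Rightarrow> nat \<Rightarrow> 'a :: classical_scalar mat" where
  "base_point n k = mat n k (\<lambda>(i, j). if i = j then 1 else 0)"

definition reduced_p :: "nat \<Rightarrow> nat \<Rightarrow> 'a :: classical_scalar mat set" where
  "reduced_p n k = {four_block_mat A B (- adj B) (0\<^sub>m (n - k) (n - k)) |A B.
     A \<in> lie k \<and> B \<in> carrier_mat k (n - k)}"

definition orthogonal_p :: "nat \<Rightarrow> nat \<Rightarrow> ('a :: classical_scalar mat \<times> 'a mat) set" where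
  "orthogonal_p n k = {(four_block_mat A B (- adj B) (0\<^sub>m (n - k) (n - k)), - A) |A B.
     A \<in> lie k \<and> B \<in> carrier_mat k (n - k)}"

definition quasi_geodesic_p :: "nat \<Rightarrow> nat \<Rightarrow> ('a :: classical_scalar mat \<times> 'a mat) set" where
  "quasi_geodesic_p n k = {(four_block_mat (0\<^sub>m k k) B (- adj B) (0\<^sub>m (n - k) (n - k)), A) |A B.
     A \<in> lie k \<and> B \<in> carrier_mat k (n - k)}"


section \<open>Induced homogeneous metrics\<close>

text \<open>\<open>c\<close> is a \<open>C\<^sup>1\<close> curve of \<open>n \<times> n\<close> matrices on \<open>[0,1]\<close>, one-sided at the end points, with
  velocity \<open>c'\<close>; all conditions are entrywise.\<close>

definition has_velocity ::
  "nat \<Rightarrow> (real \<Rightarrow> 'a :: classical_scalar mat) \<Rightarrow> (real \<Rightarrow> 'a mat) \<Rightarrow> bool" where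
  "has_velocity n c c' \<longleftrightarrow>
     (\<forall>t\<in>{0..1}. c t \<in> carrier_mat n n \<and> c' t \<in> carrier_mat n n) \<and>
     (\<forall>i<n. \<forall>j<n.
        (\<forall>t\<in>{0..1}. ((\<lambda>u. c u $$ (i, j)) has_vector_derivative c' t $$ (i, j)) (at t within {0..1})) \<and>
        continuous_on {0..1} (\<lambda>t. c' t $$ (i, j)))"

text \<open>A horizontal curve \<open>g\<close> is given together with the curve \<open>X\<close> in \<open>p\<close> such that
  \<open>g' = g X\<close>; by left invariance the speed of \<open>g\<close> is the norm of \<open>X\<close>.\<close>

definition horizontal ::
  "nat \<Rightarrow> 'a :: classical_scalar mat set \<Rightarrow> (real \<Rightarrow> 'a mat) \<Rightarrow> (real \<Rightarrow> 'a mat) \<Rightarrow> bool" where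
  "horizontal n p g X \<longleftrightarrow>
     (\<forall>t\<in>{0..1}. g t \<in> grp n \<and> X t \<in> p) \<and> has_velocity n g (\<lambda>t. g t * X t)"

definition horizontal2 ::
  "nat \<Rightarrow> nat \<Rightarrow> ('a :: classical_scalar mat \<times> 'a mat) set \<Rightarrow>
   (real \<Rightarrow> 'a mat) \<Rightarrow> (real \<Rightarrow> 'a mat) \<Rightarrow> (real \<Rightarrow> 'a mat) \<Rightarrow> (real \<Rightarrow> 'a mat) \<Rightarrow> bool" where
  "horizontal2 n k p r s X Y \<longleftrightarrow>
     (\<forall>t\<in>{0..1}. r t \<in> grp n \<and> s t \<in> grp k \<and> (X t, Y t) \<in> p) \<and>
     has_velocity n r (\<lambda>t. r t * X t) \<and> has_velocity k s (\<lambda>t. s t * Y t)"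

definition sr_length :: "(real \<Rightarrow> 'a :: classical_scalar mat) \<Rightarrow> real" where
  "sr_length X = integral {0..1} (\<lambda>t. sqrt (form (X t) (X t)))"

definition sr_length2 ::
  "(real \<Rightarrow> 'a :: classical_scalar mat) \<Rightarrow> (real \<Rightarrow> 'a mat) \<Rightarrow> real" where
  "sr_length2 X Y = integral {0..1} (\<lambda>t. sqrt (form (X t) (X t) + form (Y t) (Y t)))"

text \<open>An induced metric is represented by its length functional.  It maps a curve \<open>m\<close> in the
  Stiefel manifold to the set of the lengths of its horizontal lifts, which is empty exactly when
  there is no lift.  The inverse of \<open>s \<in> grp k\<close> is written \<open>adj s\<close>.\<close>

type_synonym 'a curve_metric = "(real \<Rightarrow> 'a mat) \<Rightarrow> real set"

definition reduced_metric :: "nat \<Rightarrow> nat \<Rightarrow> 'a :: classical_scalar curve_metric" where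
  "reduced_metric n k m = {L. (\<forall>t\<in>{0..1}. m t \<in> stiefel n k) \<and>
     (\<exists>g X. horizontal n (reduced_p n k) g X \<and>
        (\<forall>t\<in>{0..1}. g t * base_point n k = m t) \<and>
        L = sr_length X)}"

definition full_metric ::
  "('a :: classical_scalar mat \<times> 'a mat) set \<Rightarrow> nat \<Rightarrow> nat \<Rightarrow> 'a curve_metric" where
  "full_metric p n k m = {L. (\<forall>t\<in>{0..1}. m t \<in> stiefel n k) \<and>
     (\<exists>r s X Y. horizontal2 n k p r s X Y \<and>
        (\<forall>t\<in>{0..1}. r t * base_point n k * adj (s t) = m t) \<and>
        L = sr_length2 X Y)}"

abbreviation quasi_geodesic_metric :: "nat \<Rightarrow> nat \<Rightarrow> 'a :: classical_scalar curve_metric" where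
  "quasi_geodesic_metric n k \<equiv> full_metric (quasi_geodesic_p n k) n k"

abbreviation orthogonal_metric :: "nat \<Rightarrow> nat \<Rightarrow> 'a :: classical_scalar curve_metric" where
  "orthogonal_metric n k \<equiv> full_metric (orthogonal_p n k) n k"

text \<open>Two metrics count as different only if they assign different lengths to a common
  admissible curve; this implies \<open>M \<noteq> N\<close> and rules out differing merely in which curves lift.\<close>

definition different_metrics :: "'a curve_metric \<Rightarrow> 'a curve_metric \<Rightarrow> bool" where
  "different_metrics M N \<longleftrightarrow> (\<exists>m. M m \<noteq> {} \<and> N m \<noteq> {} \<and> M m \<inter> N m = {})"

end

(*
  A reduced lift g, with velocity g X and upper left block A of X, becomes a quasi-geodesic lift
  (r, s) by solving the linear equation u' = u A in G_k and putting r = g diag(u*, 1), s = u*.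
  The rotation by u* removes the block A from the first factor and moves it, conjugated by u, into
  the second factor; the block B is multiplied by a unitary matrix, so the speed does not change.
  Conversely g = r diag(s*, 1) turns a quasi-geodesic lift into a reduced one. Hence the two
  metrics agree.

  In terms of the projected curve m and the squared Frobenius norm |.|^2, the squared speed of
  every reduced lift is |m'|^2 - |m* m'|^2 / 2, and that of every orthogonal lift is
  |m'|^2 - 3/4 |m* m'|^2. For 0 \<noteq> J in the Lie algebra of G_k, the projection of the orthogonal lift
  r' = r diag(J, 0), s' = - s J satisfies |m'|^2 = |m* m'|^2 = 4 |J|^2, so its reduced and
  orthogonal lengths differ by the factor sqrt 2.
*)
theory Submission
  imports Defs
begin

text \<open>The constants come from counting blocks. On a skew matrix the trace form is half the
  squared Frobenius norm, and a horizontal vector contains A once but B twice, so its own squared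
  length is |A|^2 / 2 + |B|^2. In an orthogonal lift both the first factor and the inverse of the
  second push the base point by A: the velocity of m sees 2 A, while the two trace forms contribute
  only |A|^2 / 2 each. Rewriting |A|^2 + |B|^2 in terms of m produces the 3/4. The obstacle is to
  treat the quaternions together with the two fields. Their products do not commute, and their trace
  is cyclic only in its real part. Hence u' = u A is solved by a series over a Banach algebra and
  only real parts of traces are used. Determinants enter just to see that flows stay in SO and SU.
  Two metrics being different is a statement about all lifts of one curve, so it is not enough to
  compare two chosen lifts. A nonzero J exists over the quaternions already for k = 1, whereas so(1)
  and su(1) vanish.\<close>

section \<open>The quaternions as a Banach space\<close>

lemma quat_component_simps [simp]:
  "qre 0 = 0" "qim1 0 = 0" "qim2 0 = 0" "qim3 0 = 0"
  "qre 1 = 1" "qim1 1 = 0" "qim2 1 = 0" "qim3 1 = 0"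
  "qre (x + y) = qre x + qre y" "qim1 (x + y) = qim1 x + qim1 y"
  "qim2 (x + y) = qim2 x + qim2 y" "qim3 (x + y) = qim3 x + qim3 y"
  "qre (- x) = - qre x" "qim1 (- x) = - qim1 x" "qim2 (- x) = - qim2 x" "qim3 (- x) = - qim3 x"
  "qre (x - y) = qre x - qre y" "qim1 (x - y) = qim1 x - qim1 y"
  "qim2 (x - y) = qim2 x - qim2 y" "qim3 (x - y) = qim3 x - qim3 y"
  "qre (r *\<^sub>R x) = r * qre x" "qim1 (r *\<^sub>R x) = r * qim1 x"
  "qim2 (r *\<^sub>R x) = r * qim2 x" "qim3 (r *\<^sub>R x) = r * qim3 x"
  by (simp_all add: quat_ring_defs scaleR_quat_def)

lemma quat_component_le_norm:
  "\<bar>qre x\<bar> \<le> norm x" "\<bar>qim1 x\<bar> \<le> norm x" "\<bar>qim2 x\<bar> \<le> norm x" "\<bar>qim3 x\<bar> \<le> norm x"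
  by (auto simp: norm_quat_sqrt intro!: real_le_rsqrt)

lemma norm_quat_le: "norm x \<le> \<bar>qre x\<bar> + \<bar>qim1 x\<bar> + \<bar>qim2 x\<bar> + \<bar>qim3 x\<bar>"
proof -
  have "norm x \<le> norm (Complex (qre x) (qim1 x)) + norm (Complex (qim2 x) (qim3 x))"
    unfolding norm_quat_def norm_Pair by (rule sqrt_sum_squares_le_sum) auto
  also have "norm (Complex (qre x) (qim1 x)) \<le> \<bar>qre x\<bar> + \<bar>qim1 x\<bar>"
    using cmod_le[of "Complex (qre x) (qim1 x)"] by simp
  also have "norm (Complex (qim2 x) (qim3 x)) \<le> \<bar>qim2 x\<bar> + \<bar>qim3 x\<bar>"
    using cmod_le[of "Complex (qim2 x) (qim3 x)"] by simp
  finally show ?thesis by simp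
qed

text \<open>Completeness is inherited from the four real coordinates, each of which is 1-Lipschitz.
  It is needed for the uniform convergence of the series in
  \<open>linear_ode_solution\<close>.\<close>

instance quat :: banach
proof
  fix X :: "nat \<Rightarrow> quat"
  assume X: "Cauchy X"
  have conv: "convergent (\<lambda>n. f (X n))"
    if f: "\<And>x. \<bar>f x\<bar> \<le> norm x" "\<And>x y. f (x - y) = f x - f y" for f :: "quat \<Rightarrow> real"
  proof (rule Cauchy_convergent, rule CauchyI)
    fix e :: real
    assume "e > 0"
    then obtain M where "\<forall>m\<ge>M. \<forall>n\<ge>M. norm (X m - X n) < e"
      using CauchyD[OF X] by blast
    then show "\<exists>M. \<forall>m\<ge>M. \<forall>n\<ge>M. norm (f (X m) - f (X n)) < e"
      by (metis f order_le_less_trans real_norm_def)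
  qed
  obtain a where a: "(\<lambda>n. qre (X n)) \<longlonglongrightarrow> a"
    using conv[of qre] quat_component_le_norm by (auto simp: convergent_def)
  obtain b where b: "(\<lambda>n. qim1 (X n)) \<longlonglongrightarrow> b"
    using conv[of qim1] quat_component_le_norm by (auto simp: convergent_def)
  obtain c where c: "(\<lambda>n. qim2 (X n)) \<longlonglongrightarrow> c"
    using conv[of qim2] quat_component_le_norm by (auto simp: convergent_def)
  obtain d where d: "(\<lambda>n. qim3 (X n)) \<longlonglongrightarrow> d"
    using conv[of qim3] quat_component_le_norm by (auto simp: convergent_def)
  have "(\<lambda>n. \<bar>qre (X n) - a\<bar> + \<bar>qim1 (X n) - b\<bar> + \<bar>qim2 (X n) - c\<bar> + \<bar>qim3 (X n) - d\<bar>)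
      \<longlonglongrightarrow> \<bar>a - a\<bar> + \<bar>b - b\<bar> + \<bar>c - c\<bar> + \<bar>d - d\<bar>"
    by (intro tendsto_intros a b c d)
  then have "(\<lambda>n. X n - Quat a b c d) \<longlonglongrightarrow> 0"
    by (intro Lim_null_comparison[OF eventuallyI[OF order_trans[OF norm_quat_le]]]) auto
  then show "convergent X"
    by (auto simp: LIM_zero_iff convergent_def)
qed

section \<open>Linear differential equations\<close>

text \<open>The solution is the Peano-Baker series, that is, Picard iteration split into its
  increments. A factorial bound on the terms makes both the series and the series of derivatives
  converge uniformly. The coefficients stand to the right of the unknowns because the scalars need
  not commute.\<close>

lemma linear_ode_solution:
  fixes A :: "nat \<Rightarrow> nat \<Rightarrow> real \<Rightarrow> 'a :: {real_normed_algebra_1, banach}"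
  assumes cont: "\<And>i j. i < k \<Longrightarrow> j < k \<Longrightarrow> continuous_on {0..1} (A i j)"
  obtains x where "\<And>l. l < k \<Longrightarrow> x l 0 = c l"
    and "\<And>l t. l < k \<Longrightarrow> t \<in> {0..1} \<Longrightarrow>
      (x l has_vector_derivative (\<Sum>j<k. x j t * A j l t)) (at t within {0..1})"
proof -
  \<comment> \<open>\<open>f n\<close> is the \<open>n\<close>-fold iterated integral of
    \<open>c\<close> against \<open>A\<close>; formally the sum over all \<open>n\<close> satisfies
    x = c + integral of x A.\<close>
  define f where "f = rec_nat (\<lambda>l t. c l)
    (\<lambda>_ g l t. integral {0..t} (\<lambda>s. \<Sum>j<k. g j s * A j l s))"
  have f_0: "f 0 l t = c l" for l t
    by (simp add: f_def)
  have f_Suc: "f (Suc n) l t = integral {0..t} (\<lambda>s. \<Sum>j<k. f n j s * A j l s)" for n l t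
    by (simp add: f_def)
  have f_cont: "continuous_on {0..1} (f n l)"
    and rhs_cont: "l < k \<Longrightarrow> continuous_on {0..1} (\<lambda>s. \<Sum>j<k. f n j s * A j l s)" if "l < k" for n l
  proof -
    have "\<forall>l<k. continuous_on {0..1} (f n l)"
    proof (induction n)
      case 0
      then show ?case by (simp add: f_0)
    next
      case (Suc n)
      show ?case
      proof (intro allI impI)
        fix l
        assume "l < k"
        then have "continuous_on {0..1} (\<lambda>s. \<Sum>j<k. f n j s * A j l s)"
          using Suc cont by (intro continuous_intros) auto
        then show "continuous_on {0..1} (f (Suc n) l)"
          unfolding f_Suc
          by (intro indefinite_integral_continuous_1 integrable_continuous_real)
      qed
    qed
    then show "continuous_on {0..1} (f n l)"
      and "l < k \<Longrightarrow> continuous_on {0..1} (\<lambda>s. \<Sum>j<k. f n j s * A j l s)"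
      using that cont by (auto intro!: continuous_intros)
  qed
  have "\<exists>B. \<forall>t\<in>{0..1}. norm (A i j t) \<le> B" if "i < k" "j < k" for i j
  proof -
    have "bounded (A i j ` {0..1})"
      by (intro compact_imp_bounded compact_continuous_image cont that) auto
    then show ?thesis by (auto simp: bounded_iff)
  qed
  then obtain B where B: "\<And>i j t. i < k \<Longrightarrow> j < k \<Longrightarrow> t \<in> {0..1} \<Longrightarrow> norm (A i j t) \<le> B i j"
    by metis
  \<comment> \<open>\<open>M\<close> dominates every column sum of the norms of \<open>A\<close>,
    uniformly in time; the absolute values make it evidently nonnegative.\<close>
  define M where "M = (\<Sum>i<k. \<Sum>j<k. \<bar>B i j\<bar>)"
  define C where "C = (\<Sum>l<k. norm (c l))"
  have "M \<ge> 0" "C \<ge> 0"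
    by (auto simp: M_def C_def intro!: sum_nonneg)
  have row: "(\<Sum>i<k. norm (A i j t)) \<le> M" if "j < k" "t \<in> {0..1}" for j t
    unfolding M_def
  proof (rule sum_mono)
    fix i
    assume "i \<in> {..<k}"
    then have "norm (A i j t) \<le> \<bar>B i j\<bar>"
      using B[of i j t] that by auto
    also have "\<dots> \<le> (\<Sum>j<k. \<bar>B i j\<bar>)"
      using that by (intro member_le_sum) auto
    finally show "norm (A i j t) \<le> (\<Sum>j<k. \<bar>B i j\<bar>)" .
  qed
  have rhs_bound: "norm (\<Sum>j<k. y j * A j l t) \<le> M * b"
    if "\<And>j. j < k \<Longrightarrow> norm (y j) \<le> b" "l < k" "t \<in> {0..1}" "b \<ge> 0" for y b l t
  proof -
    have "norm (\<Sum>j<k. y j * A j l t) \<le> (\<Sum>j<k. b * norm (A j l t))"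
      using that(1) by (intro sum_norm_le order_trans[OF norm_mult_ineq] mult_right_mono) auto
    also have "\<dots> = (\<Sum>j<k. norm (A j l t)) * b"
      by (simp add: sum_distrib_left mult.commute)
    also have "\<dots> \<le> M * b"
      using row that by (intro mult_right_mono) auto
    finally show ?thesis .
  qed
  have bound: "\<forall>l<k. \<forall>t\<in>{0..1}. norm (f n l t) \<le> C * (M * t) ^ n / fact n" for n
  proof (induction n)
    case 0
    have "norm (c l) \<le> C" if "l < k" for l
      unfolding C_def using that by (intro member_le_sum) auto
    then show ?case by (simp add: f_0)
  next
    case (Suc n)
    show ?case
    proof (intro allI impI ballI)
      fix l and t :: real
      assume l: "l < k" and t: "t \<in> {0..1}"
      \<comment> \<open>\<open>H\<close> is the bound to be shown, and its derivative
        \<open>h\<close> is \<open>M\<close> times the bound for the preceding term. Since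
        \<open>H 0 = 0\<close>, integrating \<open>h\<close> gives exactly the next bound.\<close>
      define h where "h s = M * (C * (M * s) ^ n / fact n)" for s
      define H where "H s = C * (M * s) ^ Suc n / fact (Suc n)" for s
      have "(H has_vector_derivative h s) (at s within {0..t})" for s
      proof -
        have "((\<lambda>s. s ^ Suc n) has_real_derivative real (Suc n) * s ^ n) (at s within {0..t})"
          using DERIV_pow[of "Suc n" s] by simp
        from DERIV_cmult[OF this, of "C * M ^ Suc n / fact (Suc n)"]
        have "((\<lambda>s. C * M ^ Suc n / fact (Suc n) * s ^ Suc n) has_real_derivative
            C * M ^ Suc n / fact (Suc n) * (real (Suc n) * s ^ n)) (at s within {0..t})" .
        also have "C * M ^ Suc n / fact (Suc n) * (real (Suc n) * s ^ n) = h s"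
          by (simp add: h_def power_mult_distrib fact_Suc del: of_nat_Suc)
        also have "(\<lambda>s. C * M ^ Suc n / fact (Suc n) * s ^ Suc n) = H"
          by (simp add: H_def power_mult_distrib fun_eq_iff)
        finally show ?thesis
          by (simp add: has_real_derivative_iff_has_vector_derivative)
      qed
      then have h_int: "(h has_integral H t - H 0) {0..t}"
        using t by (intro fundamental_theorem_of_calculus) auto
      have "norm (f (Suc n) l t) \<le> integral {0..t} h"
        unfolding f_Suc
      proof (rule integral_norm_bound_integral)
        show "(\<lambda>s. \<Sum>j<k. f n j s * A j l s) integrable_on {0..t}"
          using t by (intro integrable_continuous_real
              continuous_on_subset[OF rhs_cont[OF l l]]) auto
        show "h integrable_on {0..t}"
          using h_int by blast
        show "norm (\<Sum>j<k. f n j s * A j l s) \<le> h s" if "s \<in> {0..t}" for s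
          unfolding h_def using Suc that t l \<open>M \<ge> 0\<close> \<open>C \<ge> 0\<close>
          by (intro rhs_bound) auto
      qed
      also have "\<dots> = C * (M * t) ^ Suc n / fact (Suc n)"
        using integral_unique[OF h_int] by (simp add: H_def)
      finally show "norm (f (Suc n) l t) \<le> C * (M * t) ^ Suc n / fact (Suc n)" .
    qed
  qed
  define b where "b n = C * (M ^ n / fact n)" for n
  have "summable (\<lambda>n. inverse (fact n) *\<^sub>R M ^ n)"
    by (rule summable_exp_generic)
  then have b: "summable b"
    unfolding b_def by (intro summable_mult) (simp add: field_simps)
  have b_nonneg: "b n \<ge> 0" for n
    using \<open>M \<ge> 0\<close> \<open>C \<ge> 0\<close> by (simp add: b_def)
  have f_le: "norm (f n l t) \<le> b n" if "l < k" "t \<in> {0..1}" for n l t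
  proof -
    have "C * (M * t) ^ n / fact n \<le> C * M ^ n / fact n"
      using that \<open>M \<ge> 0\<close> \<open>C \<ge> 0\<close>
      by (intro divide_right_mono mult_left_mono power_mono mult_left_le) auto
    with bound that show ?thesis
      unfolding b_def by (metis order_trans times_divide_eq_right)
  qed
  define x where "x l t = (\<Sum>n. f n l t)" for l t
  have f_sums: "(\<lambda>n. f n l t) sums x l t" if "l < k" "t \<in> {0..1}" for l t
    unfolding x_def using f_le[OF that] b
    by (intro summable_sums summable_comparison_test[of "\<lambda>n. f n l t" b]) auto
  \<comment> \<open>The derivatives of the terms: the constant term contributes 0, and each later
    one the integrand built from its predecessor. This shift by one is why they sum to the
    right-hand side \<open>x'\<close>.\<close>
  define f' where "f' n l t = (case n of 0 \<Rightarrow> 0 | Suc m \<Rightarrow> \<Sum>j<k. f m j t * A j l t)" for n l t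
  define x' where "x' l t = (\<Sum>j<k. x j t * A j l t)" for l t
  have f_deriv: "(f n l has_vector_derivative f' n l t) (at t within {0..1})"
    if "l < k" "t \<in> {0..1}" for n l t
  proof (cases n)
    case 0
    then show ?thesis by (simp add: f_0[abs_def] f'_def)
  next
    case (Suc m)
    then show ?thesis
      using integral_has_vector_derivative[OF rhs_cont[OF that(1) that(1)] that(2)]
      by (simp add: f'_def f_Suc[abs_def])
  qed
  have f'_sums: "(\<lambda>n. f' n l t) sums x' l t" if "l < k" "t \<in> {0..1}" for l t
  proof -
    have "(\<lambda>n. f' (Suc n) l t) sums x' l t"
      unfolding x'_def f'_def nat.case
      using f_sums that by (intro sums_sum sums_mult2) auto
    from sums_Suc[OF this] show ?thesis
      by (simp add: f'_def)
  qed
  have unif: "uniform_limit {0..1} (\<lambda>n t. \<Sum>i<n. f' i l t) (x' l) sequentially" if "l < k" for l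
  proof -
    define b' where "b' n = (case n of 0 \<Rightarrow> 0 | Suc m \<Rightarrow> M * b m)" for n
    have "summable (\<lambda>n. b' (Suc n))"
      unfolding b'_def nat.case by (intro summable_mult b)
    then have "summable b'"
      by (simp add: summable_Suc_iff)
    moreover have "norm (f' n l t) \<le> b' n" if "t \<in> {0..1}" for n t
      using \<open>l < k\<close> that f_le b_nonneg
      by (auto simp: f'_def b'_def split: nat.split intro!: rhs_bound)
    ultimately have "uniform_limit {0..1} (\<lambda>n t. \<Sum>i<n. f' i l t) (\<lambda>t. \<Sum>i. f' i l t) sequentially"
      by (intro Weierstrass_m_test) auto
    also have "?this \<longleftrightarrow> ?thesis"
      using f'_sums[OF \<open>l < k\<close>] by (intro uniform_limit_cong) (auto simp: sums_iff)
    finally show ?thesis .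
  qed
  show ?thesis
  proof
    fix l
    assume l: "l < k"
    have "(\<lambda>n. f n l 0) sums c l"
      using sums_Suc[of "\<lambda>n. f n l 0" 0] by (simp add: f_Suc f_0)
    then show "x l 0 = c l"
      using f_sums[OF l, of 0] sums_unique2 by auto
    \<comment> \<open>Termwise differentiation provides only some sum function \<open>g\<close>;
      uniqueness of sums identifies it with \<open>x\<close> on the interval, and the derivative
      carries over.\<close>
    have "\<exists>g. \<forall>t\<in>{0..1}. (\<lambda>n. f n l t) sums g t \<and>
        (g has_derivative (\<lambda>h. h *\<^sub>R x' l t)) (at t within {0..1})"
    proof (rule has_derivative_series)
      show "(f n l has_derivative (\<lambda>h. h *\<^sub>R f' n l t)) (at t within {0..1})"
        if "t \<in> {0..1}" for n t
        using f_deriv[OF l that] by (simp add: has_vector_derivative_def)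
      show "\<forall>\<^sub>F n in sequentially. \<forall>t\<in>{0..1}. \<forall>h.
          norm ((\<Sum>i<n. h *\<^sub>R f' i l t) - h *\<^sub>R x' l t) \<le> e * norm h" if "e > 0" for e
        using uniform_limitD[OF unif[OF l] that]
      proof eventually_elim
        case (elim n)
        show ?case
        proof (intro ballI allI)
          fix t h :: real
          assume "t \<in> {0..1}"
          then have "norm ((\<Sum>i<n. f' i l t) - x' l t) \<le> e"
            using elim by (auto simp: dist_norm less_imp_le)
          then show "norm ((\<Sum>i<n. h *\<^sub>R f' i l t) - h *\<^sub>R x' l t) \<le> e * norm h"
            by (simp add: mult_left_mono mult.commute[of e]
                flip: scaleR_sum_right scaleR_diff_right)
        qed
      qed
      show "(\<lambda>n. f n l 0) sums c l" by fact
    qed auto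
    then obtain g where g: "\<And>t. t \<in> {0..1} \<Longrightarrow> (\<lambda>n. f n l t) sums g t"
      "\<And>t. t \<in> {0..1} \<Longrightarrow> (g has_vector_derivative x' l t) (at t within {0..1})"
      unfolding has_vector_derivative_def by blast
    fix t :: real
    assume t: "t \<in> {0..1}"
    have "x l u = g u" if "u \<in> {0..1}" for u
      using f_sums[OF l that] g(1)[OF that] by (rule sums_unique2)
    from has_vector_derivative_transform[OF t this g(2)[OF t]]
    show "(x l has_vector_derivative (\<Sum>j<k. x j t * A j l t)) (at t within {0..1})"
      by (simp add: x'_def)
  qed
qed

section \<open>Adjoints and block matrices\<close>

lemma star_zero [simp]: "star (0 :: 'a :: star_ring) = 0"
  using star_add[of "0 :: 'a" 0] by simp

lemma star_one [simp]: "star (1 :: 'a :: star_ring) = 1"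
  by (metis mult.right_neutral star_mult star_star)

lemma star_uminus: "star (- x :: 'a :: star_ring) = - star x"
  using star_add[of x "- x"] by (simp add: minus_unique)

lemma star_sum: "star (sum f S :: 'a :: star_ring) = (\<Sum>x\<in>S. star (f x))"
  by (induction S rule: infinite_finite_induct) (simp_all add: star_add)

lemma adj_dim [simp]: "dim_row (adj A) = dim_col A" "dim_col (adj A) = dim_row A"
  by (simp_all add: adj_def)

lemma adj_carrier [simp, intro]: "A \<in> carrier_mat n m \<Longrightarrow> adj A \<in> carrier_mat m n"
  by auto

lemma index_adj [simp]: "i < dim_col A \<Longrightarrow> j < dim_row A \<Longrightarrow> adj A $$ (i, j) = star (A $$ (j, i))"
  by (simp add: adj_def)

lemma adj_adj [simp]: "adj (adj A) = A"
  by (rule eq_matI) auto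

lemma adj_one [simp]: "adj (1\<^sub>m n) = 1\<^sub>m n"
  by (rule eq_matI) auto

lemma adj_zero [simp]: "adj (0\<^sub>m n m) = 0\<^sub>m m n"
  by (rule eq_matI) auto

lemma adj_add: "A \<in> carrier_mat n m \<Longrightarrow> B \<in> carrier_mat n m \<Longrightarrow> adj (A + B) = adj A + adj B"
  by (rule eq_matI) (auto simp: star_add)

lemma adj_uminus: "adj (- A) = - adj A"
  by (rule eq_matI) (auto simp: star_uminus)

lemma index_mult_mat_sum:
  assumes "A \<in> carrier_mat n m" "B \<in> carrier_mat m p" "i < n" "j < p"
  shows "(A * B) $$ (i, j) = (\<Sum>l<m. A $$ (i, l) * B $$ (l, j))"
  using assms by (auto simp: scalar_prod_def lessThan_atLeast0)

lemma adj_mult: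
  assumes "A \<in> carrier_mat n m" "B \<in> carrier_mat m p"
  shows "adj (A * B) = adj B * adj A"
proof (rule eq_matI)
  fix i j
  assume "i < dim_row (adj B * adj A)" "j < dim_col (adj B * adj A)"
  then have ij: "i < p" "j < n"
    using assms by auto
  then have "adj (A * B) $$ (i, j) = star ((A * B) $$ (j, i))"
    using assms by simp
  also have "\<dots> = (adj B * adj A) $$ (i, j)"
    using ij assms index_mult_mat_sum[OF assms ij(2,1)]
      index_mult_mat_sum[OF adj_carrier[OF assms(2)] adj_carrier[OF assms(1)] ij]
    by (simp add: star_sum star_mult)
  finally show "adj (A * B) $$ (i, j) = (adj B * adj A) $$ (i, j)" .
qed (use assms in auto)

lemma adj_four_block:
  assumes "A \<in> carrier_mat n1 m1" "B \<in> carrier_mat n1 m2" "C \<in> carrier_mat n2 m1" "D \<in> carrier_mat n2 m2"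
  shows "adj (four_block_mat A B C D) = four_block_mat (adj A) (adj C) (adj B) (adj D)"
  by (rule eq_matI) (use assms in auto)

text \<open>The premises speak of dimensions instead of carriers, so they contain no variables
  beyond those of the rewritten term and the simplifier can discharge them. The same holds for the
  other rules in \<open>mat_dim_simps\<close>.\<close>

lemma mat_mult_assoc_dim:
  fixes A B C :: "'a :: semiring_0 mat"
  shows "dim_col A = dim_row B \<Longrightarrow> dim_col B = dim_row C \<Longrightarrow> A * B * C = A * (B * C)"
  by (rule assoc_mult_mat) auto

text \<open>Right-nested products hide a factor \<open>adj u * u\<close> across a bracket; this rule
  cancels it there.\<close>

lemma mat_mult_cancel_dim:
  fixes A B C :: "'a :: semiring_1 mat"
  assumes "A * B = 1\<^sub>m (dim_row C)" "dim_col A = dim_row B" "dim_col B = dim_row C"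
  shows "A * (B * C) = C"
  using assms by (simp flip: mat_mult_assoc_dim)

lemma mat_mult_add_dim:
  fixes A B C :: "'a :: semiring_0 mat"
  shows "dim_col A = dim_row B \<Longrightarrow> dim_row B = dim_row C \<Longrightarrow> dim_col B = dim_col C \<Longrightarrow>
    A * (B + C) = A * B + A * C"
  by (rule mult_add_distrib_mat) auto

lemma mat_add_mult_dim:
  fixes A B C :: "'a :: semiring_0 mat"
  shows "dim_col A = dim_row C \<Longrightarrow> dim_row A = dim_row B \<Longrightarrow> dim_col A = dim_col B \<Longrightarrow>
    (A + B) * C = A * C + B * C"
  by (rule add_mult_distrib_mat) auto

lemma adj_mult_dim: "dim_col A = dim_row B \<Longrightarrow> adj (A * B) = adj B * adj A"
  by (rule adj_mult) auto

lemma mat_uminus_uminus: "- (- A) = (A :: 'a :: group_add mat)"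
  by (rule eq_matI) auto

lemma mat_uminus_zero [simp]: "- 0\<^sub>m n m = (0\<^sub>m n m :: 'a :: group_add mat)"
  by (rule eq_matI) auto

lemmas mat_dim_simps = mat_mult_assoc_dim mat_mult_add_dim mat_add_mult_dim adj_mult_dim
  uminus_mult_left_mat uminus_mult_right_mat mat_uminus_uminus

lemma skew_matsD:
  "X \<in> skew_mats n \<Longrightarrow> X \<in> carrier_mat n n"
  "X \<in> skew_mats n \<Longrightarrow> adj X = - X"
  by (auto simp: skew_mats_def)

lemma unitary_matsD:
  "g \<in> unitary_mats n \<Longrightarrow> g \<in> carrier_mat n n"
  "g \<in> unitary_mats n \<Longrightarrow> adj g * g = 1\<^sub>m n"
  "g \<in> unitary_mats n \<Longrightarrow> g * adj g = 1\<^sub>m n"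
  by (auto simp: unitary_mats_def)

section \<open>The embedding of G_k into G_n and the base point\<close>

text \<open>This is the embedding diag(U, 1) of the overview, with \<open>q\<close> the size of the
  identity block.\<close>

definition blk :: "nat \<Rightarrow> 'a :: semiring_1 mat \<Rightarrow> 'a mat" where
  "blk q U = four_block_mat U (0\<^sub>m (dim_row U) q) (0\<^sub>m q (dim_col U)) (1\<^sub>m q)"

lemma blk_carrier [simp, intro]: "U \<in> carrier_mat k k \<Longrightarrow> blk q U \<in> carrier_mat (k + q) (k + q)"
  by (auto simp: blk_def)

lemma adj_blk: "adj (blk q U) = blk q (adj U)"
  by (simp add: blk_def adj_four_block[of U "dim_row U" "dim_col U" _ q _ q])

lemma blk_one: "blk q (1\<^sub>m k) = 1\<^sub>m (k + q)"
  unfolding blk_def by (rule eq_matI) auto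

lemma blk_mult_four_block:
  fixes U :: "'a :: semiring_1 mat"
  assumes "U \<in> carrier_mat k k" "A \<in> carrier_mat k m1" "B \<in> carrier_mat k m2"
    "C \<in> carrier_mat q m1" "D \<in> carrier_mat q m2"
  shows "blk q U * four_block_mat A B C D = four_block_mat (U * A) (U * B) C D"
proof -
  have "blk q U * four_block_mat A B C D = four_block_mat (U * A + 0\<^sub>m k q * C) (U * B + 0\<^sub>m k q * D)
      (0\<^sub>m q k * A + 1\<^sub>m q * C) (0\<^sub>m q k * B + 1\<^sub>m q * D)"
    unfolding blk_def using assms
    by (subst mult_four_block_mat[OF _ _ _ _ assms(2-)]) auto
  then show ?thesis
    using assms by simp
qed

lemma four_block_mult_blk:
  fixes U :: "'a :: semiring_1 mat"
  assumes "U \<in> carrier_mat k k" "A \<in> carrier_mat n1 k" "B \<in> carrier_mat n1 q"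
    "C \<in> carrier_mat n2 k" "D \<in> carrier_mat n2 q"
  shows "four_block_mat A B C D * blk q U = four_block_mat (A * U) B (C * U) D"
proof -
  have "four_block_mat A B C D * blk q U = four_block_mat (A * U + B * 0\<^sub>m q k) (A * 0\<^sub>m k q + B * 1\<^sub>m q)
      (C * U + D * 0\<^sub>m q k) (C * 0\<^sub>m k q + D * 1\<^sub>m q)"
    unfolding blk_def using assms
    by (subst mult_four_block_mat[OF assms(2-)]) auto
  then show ?thesis
    using assms by simp
qed

lemma blk_mult:
  fixes U :: "'a :: semiring_1 mat"
  assumes "U \<in> carrier_mat k k" "V \<in> carrier_mat k k"
  shows "blk q U * blk q V = blk q (U * V)"
proof -
  have "blk q U * blk q V = four_block_mat (U * V) (U * 0\<^sub>m k q) (0\<^sub>m q k) (1\<^sub>m q)"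
    using blk_mult_four_block[OF assms zero_carrier_mat zero_carrier_mat one_carrier_mat, of q] assms
    by (simp add: blk_def)
  then show ?thesis
    using assms by (simp add: blk_def)
qed

lemma blk_unitary:
  assumes "U \<in> unitary_mats k"
  shows "blk q U \<in> unitary_mats (k + q)"
  using assms unfolding unitary_mats_def by (simp add: adj_blk blk_mult[of _ k] blk_one)

lemma det_blk:
  fixes U :: "'a :: idom mat"
  assumes "U \<in> carrier_mat k k"
  shows "det (blk q U) = det U"
  using assms det_four_block_mat_upper_right_zero[OF assms refl zero_carrier_mat one_carrier_mat, of q]
  by (simp add: blk_def)

lemma base_point_carrier [simp, intro]: "base_point n k \<in> carrier_mat n k"
  by (simp add: base_point_def)

text \<open>The blocks on the right have width 0. In this form a tall matrix is also a block matrix,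
  and block multiplication applies to it.\<close>

lemma base_point_four_block:
  "base_point (k + q) k = four_block_mat (1\<^sub>m k) (0\<^sub>m k 0) (0\<^sub>m q k) (0\<^sub>m q 0)"
  by (rule eq_matI) (auto simp: base_point_def)

lemma four_block_mult_base_point:
  fixes A :: "'a :: classical_scalar mat"
  assumes "A \<in> carrier_mat k k" "B \<in> carrier_mat k q" "C \<in> carrier_mat q k" "D \<in> carrier_mat q q"
  shows "four_block_mat A B C D * base_point (k + q) k = four_block_mat A (0\<^sub>m k 0) C (0\<^sub>m q 0)"
  unfolding base_point_four_block using assms
  by (subst mult_four_block_mat[OF assms]) (auto intro!: arg_cong[of _ _ "\<lambda>X. four_block_mat _ X _ _"])

text \<open>Both sides are \<open>U\<close> on top of zeros. The identity converts a right factor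
  diag(U, 1) in G_n into a right factor \<open>U\<close> on the Stiefel manifold, which is how the
  action of G_k is absorbed into that of G_n.\<close>

lemma blk_mult_base_point:
  fixes U :: "'a :: classical_scalar mat"
  assumes "U \<in> carrier_mat k k"
  shows "blk q U * base_point (k + q) k = base_point (k + q) k * U"
proof -
  have "blk q U * base_point (k + q) k = four_block_mat U (0\<^sub>m k 0) (0\<^sub>m q k) (0\<^sub>m q 0)"
    unfolding blk_def using assms by (intro four_block_mult_base_point[THEN trans]) auto
  also have "\<dots> = base_point (k + q) k * four_block_mat U (0\<^sub>m k 0) (0\<^sub>m 0 k) (0\<^sub>m 0 0)"
    unfolding base_point_four_block using assms
    by (subst mult_four_block_mat[of _ k k _ 0 _ q]) auto
  also have "four_block_mat U (0\<^sub>m k 0) (0\<^sub>m 0 k) (0\<^sub>m 0 0) = U"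
    using assms by (intro eq_matI) auto
  finally show ?thesis .
qed

text \<open>The adjoint of the base point cuts out the first \<open>k\<close> rows. This is how the
  product of m* with the velocity of m recovers the upper block.\<close>

lemma adj_base_point_mult:
  fixes A :: "'a :: classical_scalar mat"
  assumes "A \<in> carrier_mat k k" "C \<in> carrier_mat q k"
  shows "adj (base_point (k + q) k) * four_block_mat A (0\<^sub>m k 0) C (0\<^sub>m q 0) = A"
proof -
  have "adj (base_point (k + q) k :: 'a mat) = four_block_mat (1\<^sub>m k) (0\<^sub>m k q) (0\<^sub>m 0 k) (0\<^sub>m 0 q)"
    unfolding base_point_four_block by (subst adj_four_block) auto
  then have "adj (base_point (k + q) k) * four_block_mat A (0\<^sub>m k 0) C (0\<^sub>m q 0) =
      four_block_mat (1\<^sub>m k) (0\<^sub>m k q) (0\<^sub>m 0 k) (0\<^sub>m 0 q) * four_block_mat A (0\<^sub>m k 0) C (0\<^sub>m q 0)"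
    by simp
  also have "four_block_mat (1\<^sub>m k) (0\<^sub>m k q) (0\<^sub>m 0 k) (0\<^sub>m 0 q) * four_block_mat A (0\<^sub>m k 0) C (0\<^sub>m q 0) = four_block_mat A (0\<^sub>m k 0) (0\<^sub>m 0 k) (0\<^sub>m 0 0)"
    using assms by (subst mult_four_block_mat[of _ k k _ q _ 0]) auto
  also have "\<dots> = A"
    using assms by (intro eq_matI) auto
  finally show ?thesis .
qed


section \<open>Calculus of matrix-valued curves\<close>

text \<open>\<open>has_velocity\<close> is split into this notion and \<open>mat_cont\<close>: the
  product rule does not involve continuity of the velocity, and curves in the Stiefel manifold are
  rectangular.\<close>

definition mat_deriv ::
  "nat \<Rightarrow> nat \<Rightarrow> (real \<Rightarrow> 'a :: real_normed_algebra_1 mat) \<Rightarrow> (real \<Rightarrow> 'a mat) \<Rightarrow> bool" where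
  "mat_deriv n m c c' \<longleftrightarrow>
     (\<forall>t\<in>{0..1}. c t \<in> carrier_mat n m \<and> c' t \<in> carrier_mat n m \<and>
        (\<forall>i<n. \<forall>j<m.
          ((\<lambda>u. c u $$ (i, j)) has_vector_derivative c' t $$ (i, j)) (at t within {0..1})))"

definition mat_cont :: "nat \<Rightarrow> nat \<Rightarrow> (real \<Rightarrow> 'a :: real_normed_algebra_1 mat) \<Rightarrow> bool" where
  "mat_cont n m c \<longleftrightarrow> (\<forall>t\<in>{0..1}. c t \<in> carrier_mat n m) \<and>
     (\<forall>i<n. \<forall>j<m. continuous_on {0..1} (\<lambda>t. c t $$ (i, j)))"

lemma has_velocity_iff: "has_velocity n c c' \<longleftrightarrow> mat_deriv n n c c' \<and> mat_cont n n c'"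
  by (auto simp: has_velocity_def mat_deriv_def mat_cont_def)

lemma mat_contD: "mat_cont n m c \<Longrightarrow> t \<in> {0..1} \<Longrightarrow> c t \<in> carrier_mat n m"
  by (simp add: mat_cont_def)

lemma mat_derivD:
  assumes "mat_deriv n m c c'" "t \<in> {0..1}"
  shows "c t \<in> carrier_mat n m" "c' t \<in> carrier_mat n m"
    "i < n \<Longrightarrow> j < m \<Longrightarrow>
      ((\<lambda>u. c u $$ (i, j)) has_vector_derivative c' t $$ (i, j)) (at t within {0..1})"
  using assms by (simp_all add: mat_deriv_def)

lemma mat_deriv_cong:
  assumes "mat_deriv n m c c'" "\<And>t. t \<in> {0..1} \<Longrightarrow> d t = c t" "\<And>t. t \<in> {0..1} \<Longrightarrow> d' t = c' t"
  shows "mat_deriv n m d d'"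
  unfolding mat_deriv_def
proof (intro ballI conjI allI impI)
  fix t :: real and i j
  assume t: "t \<in> {0..1}" and "i < n" "j < m"
  show "((\<lambda>u. d u $$ (i, j)) has_vector_derivative d' t $$ (i, j)) (at t within {0..1})"
    unfolding assms(3)[OF t] using assms(2)
    by (intro has_vector_derivative_transform[OF t _ mat_derivD(3)[OF assms(1) t]]) (simp_all add: \<open>i < n\<close> \<open>j < m\<close>)
qed (use assms mat_derivD[OF assms(1)] in simp_all)

lemma mat_cont_cong:
  assumes "mat_cont n m c" "\<And>t. t \<in> {0..1} \<Longrightarrow> d t = c t"
  shows "mat_cont n m d"
  unfolding mat_cont_def
proof (intro conjI allI impI ballI)
  fix i j
  assume "i < n" "j < m"
  then have "continuous_on {0..1} (\<lambda>t. c t $$ (i, j))"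
    using assms(1) by (simp add: mat_cont_def)
  then show "continuous_on {0..1} (\<lambda>t. d t $$ (i, j))"
    by (rule continuous_on_eq) (simp add: assms(2))
qed (use assms in \<open>simp add: mat_cont_def\<close>)

lemma mat_deriv_imp_cont: "mat_deriv n m c c' \<Longrightarrow> mat_cont n m c"
  unfolding mat_cont_def mat_deriv_def continuous_on_eq_continuous_within
  by (meson has_vector_derivative_continuous)

text \<open>On a nondegenerate interval derivatives are unique even at the end points. So the
  velocity of a projected curve may be computed from whichever lift is at hand.\<close>

lemma mat_deriv_unique:
  assumes "mat_deriv n m c c'" "mat_deriv n m c d'" "t \<in> {0..1}"
  shows "c' t = d' t"
proof (rule eq_matI)
  fix i j
  assume "i < dim_row (d' t)" "j < dim_col (d' t)"
  then have "i < n" "j < m"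
    using mat_derivD(2)[OF assms(2,3)] by auto
  then show "c' t $$ (i, j) = d' t $$ (i, j)"
    using mat_derivD(3)[OF assms(1,3)] mat_derivD(3)[OF assms(2,3)] assms(3)
    by (intro vector_derivative_unique_within_closed_interval[of 0 1 t]) (simp_all add: cbox_interval)
qed (use mat_derivD(2)[OF assms(1,3)] mat_derivD(2)[OF assms(2,3)] in auto)

lemma mat_cont_const: "M \<in> carrier_mat n m \<Longrightarrow> mat_cont n m (\<lambda>_. M)"
  by (simp add: mat_cont_def)

lemma mat_deriv_const: "M \<in> carrier_mat n m \<Longrightarrow> mat_deriv n m (\<lambda>_. M) (\<lambda>_. 0\<^sub>m n m)"
  by (simp add: mat_deriv_def)

lemma mat_cont_add:
  assumes "mat_cont n m c" "mat_cont n m d"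
  shows "mat_cont n m (\<lambda>t. c t + d t)"
  unfolding mat_cont_def
proof (intro conjI allI impI ballI)
  fix i j
  assume "i < n" "j < m"
  then have "continuous_on {0..1} (\<lambda>t. c t $$ (i, j) + d t $$ (i, j))"
    using assms by (intro continuous_on_add) (simp_all add: mat_cont_def)
  then show "continuous_on {0..1} (\<lambda>t. (c t + d t) $$ (i, j))"
    by (rule continuous_on_eq) (use carrier_matD[OF mat_contD[OF assms(2)]] \<open>i < n\<close> \<open>j < m\<close> in simp)
qed (use mat_contD[OF assms(1)] mat_contD[OF assms(2)] in simp)

lemma mat_cont_uminus:
  assumes "mat_cont n m c"
  shows "mat_cont n m (\<lambda>t. - c t)"
  unfolding mat_cont_def
proof (intro conjI allI impI ballI)
  fix i j
  assume "i < n" "j < m"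
  then have "continuous_on {0..1} (\<lambda>t. - c t $$ (i, j))"
    using assms by (intro continuous_on_minus) (simp_all add: mat_cont_def)
  then show "continuous_on {0..1} (\<lambda>t. (- c t) $$ (i, j))"
    by (rule continuous_on_eq) (use carrier_matD[OF mat_contD[OF assms]] \<open>i < n\<close> \<open>j < m\<close> in simp)
qed (use mat_contD[OF assms] in simp)

lemma mat_cont_mult:
  assumes "mat_cont n m c" "mat_cont m p d"
  shows "mat_cont n p (\<lambda>t. c t * d t)"
  unfolding mat_cont_def
proof (intro conjI allI impI ballI)
  fix i j
  assume "i < n" "j < p"
  then have "continuous_on {0..1} (\<lambda>t. \<Sum>l<m. c t $$ (i, l) * d t $$ (l, j))"
    using assms by (auto simp: mat_cont_def intro!: continuous_intros)
  then show "continuous_on {0..1} (\<lambda>t. (c t * d t) $$ (i, j))"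
    by (rule continuous_on_eq)
      (use index_mult_mat_sum[OF mat_contD[OF assms(1)] mat_contD[OF assms(2)]] \<open>i < n\<close> \<open>j < p\<close> in auto)
qed (rule mult_carrier_mat[OF mat_contD[OF assms(1)] mat_contD[OF assms(2)]])

lemma mat_deriv_mult:
  assumes "mat_deriv n m c c'" "mat_deriv m p d d'"
  shows "mat_deriv n p (\<lambda>t. c t * d t) (\<lambda>t. c t * d' t + c' t * d t)"
  unfolding mat_deriv_def
proof (intro conjI allI impI ballI)
  fix t :: real and i j
  assume t: "t \<in> {0..1}" and ij: "i < n" "j < p"
  note C = mat_derivD(1,2)[OF assms(1)] and D = mat_derivD(1,2)[OF assms(2)]
  have "((\<lambda>u. \<Sum>l<m. c u $$ (i, l) * d u $$ (l, j)) has_vector_derivative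
      (\<Sum>l<m. c t $$ (i, l) * d' t $$ (l, j) + c' t $$ (i, l) * d t $$ (l, j))) (at t within {0..1})"
    using mat_derivD(3)[OF assms(1) t] mat_derivD(3)[OF assms(2) t] ij
    by (intro has_vector_derivative_sum has_vector_derivative_mult) auto
  also have "(\<Sum>l<m. c t $$ (i, l) * d' t $$ (l, j) + c' t $$ (i, l) * d t $$ (l, j)) =
      (c t * d' t) $$ (i, j) + (c' t * d t) $$ (i, j)"
    using C[OF t] D[OF t] ij by (simp add: index_mult_mat_sum sum.distrib del: index_mult_mat(1))
  also have "\<dots> = (c t * d' t + c' t * d t) $$ (i, j)"
    using C[OF t] D[OF t] ij by simp
  finally show "((\<lambda>u. (c u * d u) $$ (i, j)) has_vector_derivative
      (c t * d' t + c' t * d t) $$ (i, j)) (at t within {0..1})"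
    by (rule has_vector_derivative_transform[OF t, rotated])
      (use index_mult_mat_sum[OF C(1) D(1)] ij in auto)
next
  fix t :: real
  assume t: "t \<in> {0..1}"
  note C = mat_derivD(1,2)[OF assms(1) t] and D = mat_derivD(1,2)[OF assms(2) t]
  show "c t * d t \<in> carrier_mat n p" "c t * d' t + c' t * d t \<in> carrier_mat n p"
    using C D by (simp_all add: mult_carrier_mat[of _ n m])
qed

lemma mat_deriv_mult_const:
  assumes "mat_deriv n m c c'" "M \<in> carrier_mat m p"
  shows "mat_deriv n p (\<lambda>t. c t * M) (\<lambda>t. c' t * M)"
proof (rule mat_deriv_cong[OF mat_deriv_mult[OF assms(1) mat_deriv_const[OF assms(2)]]])
  fix t :: real
  assume "t \<in> {0..1}"
  with assms(2) mat_derivD(1,2)[OF assms(1) this]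
  show "c' t * M = c t * 0\<^sub>m m p + c' t * M" by simp
qed simp

lemma mat_cont_four_block:
  assumes "mat_cont n1 m1 A" "mat_cont n1 m2 B" "mat_cont n2 m1 C" "mat_cont n2 m2 D"
  shows "mat_cont (n1 + n2) (m1 + m2) (\<lambda>t. four_block_mat (A t) (B t) (C t) (D t))"
  unfolding mat_cont_def
proof (intro conjI allI impI ballI)
  fix i j
  assume ij: "i < n1 + n2" "j < m1 + m2"
  have "continuous_on {0..1} (\<lambda>t. if i < n1
      then if j < m1 then A t $$ (i, j) else B t $$ (i, j - m1)
      else if j < m1 then C t $$ (i - n1, j) else D t $$ (i - n1, j - m1))"
    using assms ij by (cases "i < n1"; cases "j < m1") (simp_all add: mat_cont_def)
  then show "continuous_on {0..1} (\<lambda>t. four_block_mat (A t) (B t) (C t) (D t) $$ (i, j))"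
    by (rule continuous_on_eq) (use carrier_matD[OF mat_contD[OF assms(1)]] carrier_matD[OF mat_contD[OF assms(4)]] ij in simp)
qed (use mat_contD[OF assms(1)] mat_contD[OF assms(4)] in auto)

lemma mat_deriv_blk:
  assumes "mat_deriv k k u u'"
  shows "mat_deriv (k + q) (k + q) (\<lambda>t. blk q (u t))
    (\<lambda>t. four_block_mat (u' t) (0\<^sub>m k q) (0\<^sub>m q k) (0\<^sub>m q q))"
  unfolding mat_deriv_def
proof (intro conjI allI impI ballI)
  fix t :: real and i j
  assume t: "t \<in> {0..1}" and ij: "i < k + q" "j < k + q"
  note U = mat_derivD(1,2)[OF assms]
  define e where "e u = (if i < k then if j < k then u $$ (i, j) else 0 else if j < k then 0
      else 1\<^sub>m q $$ (i - k, j - k))" for u :: "'a mat"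
  define e' where "e' = (if i < k then if j < k then u' t $$ (i, j) else 0 else 0)"
  have "((\<lambda>s. e (u s)) has_vector_derivative e') (at t within {0..1})"
    using mat_derivD(3)[OF assms t] by (auto simp: e_def e'_def)
  also have "e' = four_block_mat (u' t) (0\<^sub>m k q) (0\<^sub>m q k) (0\<^sub>m q q) $$ (i, j)"
    using U[OF t] ij by (auto simp: e'_def)
  finally show "((\<lambda>s. blk q (u s) $$ (i, j)) has_vector_derivative
      four_block_mat (u' t) (0\<^sub>m k q) (0\<^sub>m q k) (0\<^sub>m q q) $$ (i, j)) (at t within {0..1})"
  proof (rule has_vector_derivative_transform[OF t, rotated])
    show "blk q (u s) $$ (i, j) = e (u s)" if "s \<in> {0..1}" for s
      using U(1)[OF that] ij by (auto simp: e_def blk_def)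
  qed
qed (use mat_derivD(1,2)[OF assms] in auto)

text \<open>The rows of \<open>u\<close> decouple: row \<open>i\<close> solves the vector equation
  of \<open>linear_ode_solution\<close>, starting at the \<open>i\<close>-th unit vector.\<close>

lemma mat_ode_solution:
  fixes A :: "real \<Rightarrow> 'a :: {real_normed_algebra_1, banach} mat"
  assumes "mat_cont k k A"
  obtains u where "mat_deriv k k u (\<lambda>t. u t * A t)" "u 0 = 1\<^sub>m k"
proof -
  have "\<exists>x. \<forall>l<k. x l 0 = 1\<^sub>m k $$ (i, l) \<and> (\<forall>t\<in>{0..1}.
      (x l has_vector_derivative (\<Sum>j<k. x j t * A t $$ (j, l))) (at t within {0..1}))" for i
  proof -
    have "continuous_on {0..1} (\<lambda>t. A t $$ (j, l))" if "j < k" "l < k" for j l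
      using assms that by (simp add: mat_cont_def)
    from linear_ode_solution[of k "\<lambda>j l t. A t $$ (j, l)" "\<lambda>l. 1\<^sub>m k $$ (i, l)", OF this]
    show ?thesis by metis
  qed
  then obtain x where x: "\<And>i l. l < k \<Longrightarrow> x i l 0 = 1\<^sub>m k $$ (i, l)"
    "\<And>i l t. l < k \<Longrightarrow> t \<in> {0..1} \<Longrightarrow>
      (x i l has_vector_derivative (\<Sum>j<k. x i j t * A t $$ (j, l))) (at t within {0..1})"
    by metis
  define u where "u t = mat k k (\<lambda>(i, j). x i j t)" for t
  have u: "u t \<in> carrier_mat k k" "i < k \<Longrightarrow> j < k \<Longrightarrow> u t $$ (i, j) = x i j t" for t i j
    by (simp_all add: u_def)
  show ?thesis
  proof
    show "u 0 = 1\<^sub>m k"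
      by (rule eq_matI) (auto simp: u_def x)
    show "mat_deriv k k u (\<lambda>t. u t * A t)"
      unfolding mat_deriv_def
      using x(2) u mat_contD[OF assms] mult_carrier_mat[OF u(1) mat_contD[OF assms]]
      by (auto simp: index_mult_mat_sum[OF u(1) mat_contD[OF assms]])
  qed
qed

lemma mat_deriv_zero_imp_constant:
  assumes "mat_deriv n m c (\<lambda>_. 0\<^sub>m n m)" "t \<in> {0..1}"
  shows "c t = c 0"
proof (rule eq_matI)
  note C = mat_derivD(1)[OF assms(1)]
  have z: "(0 :: real) \<in> {0..1}" by simp
  fix i j
  assume "i < dim_row (c 0)" "j < dim_col (c 0)"
  then have ij: "i < n" "j < m"
    using C[OF z] by auto
  have "((\<lambda>u. c u $$ (i, j)) has_derivative (\<lambda>h. 0)) (at s within {0..1})" if "s \<in> {0..1}" for s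
    using mat_derivD(3)[OF assms(1) that ij] ij by (simp add: has_vector_derivative_def)
  then obtain a where "\<forall>s\<in>{0..1}. c s $$ (i, j) = a"
    using has_derivative_zero_constant[of "{0..1::real}" "\<lambda>u. c u $$ (i, j)"] by auto
  then show "c t $$ (i, j) = c 0 $$ (i, j)"
    using assms(2) by simp
qed (use mat_derivD(1)[OF assms(1) assms(2)] mat_derivD(1)[OF assms(1), of 0] in auto)

section \<open>Determinants along flows\<close>

text \<open>Jacobi's formula at the identity. Differentiating a summand of the Leibniz expansion
  leaves all but one factor evaluated at the identity matrix, so only the identity permutation
  contributes, and it contributes the trace.\<close>

lemma det_has_derivative_at_one:
  fixes w :: "real \<Rightarrow> 'a :: real_normed_field mat"
  assumes "\<And>s. s \<in> S \<Longrightarrow> w s \<in> carrier_mat n n" "t \<in> S" "w t = 1\<^sub>m n" "W \<in> carrier_mat n n"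
    and W: "\<And>i j. i < n \<Longrightarrow> j < n \<Longrightarrow>
      ((\<lambda>s. w s $$ (i, j)) has_vector_derivative W $$ (i, j)) (at t within S)"
  shows "((\<lambda>s. det (w s)) has_vector_derivative tr W) (at t within S)"
proof -
  define P where "P = {p. p permutes {0..<n}}"
  have "finite P"
    unfolding P_def by (rule finite_permutations) simp
  have minor: "(\<Prod>j\<in>{0..<n} - {i}. w t $$ (j, p j)) = (if p = id then 1 else 0)"
    if p: "p \<in> P" and "i < n" for p i
  proof (cases "p = id")
    case True
    then show ?thesis by (simp add: \<open>w t = 1\<^sub>m n\<close>)
  next
    case False
    have perm: "p permutes {0..<n}"
      using p by (simp add: P_def)
    from False obtain a where a: "p a \<noteq> a"
      by (auto simp: fun_eq_iff)
    have moved: "a < n \<and> p a < n \<and> p (p a) \<noteq> p a"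
      using perm a permutes_in_image[OF perm, of a]
      by (metis atLeastLessThan_iff le0 permutes_def)
    \<comment> \<open>A nontrivial permutation moves at least two points, one of which differs from \<open>i\<close>.\<close>
    define b where "b = (if a = i then p a else a)"
    have "b \<in> {0..<n} - {i}" "w t $$ (b, p b) = 0"
      using moved a permutes_in_image[OF perm, of "p a"] by (auto simp: b_def \<open>w t = 1\<^sub>m n\<close>)
    then show ?thesis
      using False by (auto intro!: prod_zero)
  qed
  have "((\<lambda>s. \<Sum>p\<in>P. signof p * (\<Prod>i=0..<n. w s $$ (i, p i))) has_derivative
      (\<lambda>h. \<Sum>p\<in>P. signof p * (\<Sum>i=0..<n. h *\<^sub>R W $$ (i, p i) * (\<Prod>j\<in>{0..<n} - {i}. w t $$ (j, p j)))))
      (at t within S)"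
  proof (intro has_derivative_sum has_derivative_mult_right has_derivative_prod)
    fix p i
    assume "p \<in> P" "i \<in> {0..<n}"
    then have "p i < n"
      using permutes_in_image[of p "{0..<n}" i] by (simp add: P_def)
    then show "((\<lambda>s. w s $$ (i, p i)) has_derivative (\<lambda>h. h *\<^sub>R W $$ (i, p i))) (at t within S)"
      using W[of i "p i"] \<open>i \<in> {0..<n}\<close> by (simp add: has_vector_derivative_def)
  qed
  also have "(\<lambda>h. \<Sum>p\<in>P. signof p * (\<Sum>i=0..<n. h *\<^sub>R W $$ (i, p i) *
      (\<Prod>j\<in>{0..<n} - {i}. w t $$ (j, p j)))) = (\<lambda>h. h *\<^sub>R tr W)"
  proof
    fix h :: real
    have "(\<Sum>p\<in>P. signof p * (\<Sum>i=0..<n. h *\<^sub>R W $$ (i, p i) * (\<Prod>j\<in>{0..<n} - {i}. w t $$ (j, p j))))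
        = (\<Sum>p\<in>P. if p = id then h *\<^sub>R tr W else 0)"
    proof (rule sum.cong)
      fix p
      assume "p \<in> P"
      then have "(\<Sum>i=0..<n. h *\<^sub>R W $$ (i, p i) * (\<Prod>j\<in>{0..<n} - {i}. w t $$ (j, p j)))
          = (\<Sum>i=0..<n. h *\<^sub>R W $$ (i, p i) * (if p = id then 1 else 0))"
        by (intro sum.cong) (simp_all add: minor)
      then show "signof p * (\<Sum>i=0..<n. h *\<^sub>R W $$ (i, p i) * (\<Prod>j\<in>{0..<n} - {i}. w t $$ (j, p j)))
          = (if p = id then h *\<^sub>R tr W else 0)"
        using \<open>W \<in> carrier_mat n n\<close>
        by (auto simp: tr_def scaleR_sum_right lessThan_atLeast0)
    qed simp
    also have "\<dots> = h *\<^sub>R tr W"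
      using \<open>finite P\<close> by (simp add: P_def permutes_id)
    finally show "(\<Sum>p\<in>P. signof p * (\<Sum>i=0..<n. h *\<^sub>R W $$ (i, p i) *
        (\<Prod>j\<in>{0..<n} - {i}. w t $$ (j, p j)))) = h *\<^sub>R tr W" .
  qed
  finally have "((\<lambda>s. \<Sum>p\<in>P. signof p * (\<Prod>i=0..<n. w s $$ (i, p i))) has_vector_derivative tr W)
      (at t within S)"
    by (simp add: has_vector_derivative_def)
  then show ?thesis
    by (rule has_vector_derivative_transform[OF \<open>t \<in> S\<close>, rotated])
      (simp add: P_def det_def'[OF assms(1)])
qed

text \<open>Translate by \<open>adj (u t)\<close>: the curve \<open>adj (u t) * u s\<close> passes
  through the identity at \<open>s = t\<close> with velocity \<open>A t\<close>. By Jacobi's formula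
  the determinant of \<open>u\<close> then has derivative \<open>det (u t) * tr (A t)\<close>, which
  is 0.\<close>

lemma det_flow_eq_one:
  fixes u :: "real \<Rightarrow> 'a :: {real_normed_field, star_ring} mat"
  assumes u: "mat_deriv n n u (\<lambda>t. u t * A t)" "u 0 = 1\<^sub>m n"
    and A: "\<And>t. t \<in> {0..1} \<Longrightarrow> A t \<in> carrier_mat n n" "\<And>t. t \<in> {0..1} \<Longrightarrow> tr (A t) = 0"
    and unitary: "\<And>t. t \<in> {0..1} \<Longrightarrow> u t \<in> unitary_mats n"
    and t: "t \<in> {0..1}"
  shows "det (u t) = 1"
proof -
  have "((\<lambda>s. det (u s)) has_derivative (\<lambda>h. 0)) (at t within {0..1})" if t: "t \<in> {0..1}" for t
  proof -
    define v where "v = adj (u t)"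
    have ut: "u s \<in> carrier_mat n n" if "s \<in> {0..1}" for s
      using mat_derivD(1)[OF u(1) that] .
    have v: "v \<in> carrier_mat n n" "v * u t = 1\<^sub>m n" "u t * v = 1\<^sub>m n"
      using unitary[OF t] by (auto simp: v_def unitary_mats_def)
    have "mat_deriv n n (\<lambda>s. v * u s) (\<lambda>s. v * (u s * A s) + 0\<^sub>m n n * u s)"
      by (rule mat_deriv_mult[OF mat_deriv_const[OF v(1)] u(1)])
    moreover have "v * (u t * A t) + 0\<^sub>m n n * u t = A t"
      using v A(1)[OF t] ut[OF t] assoc_mult_mat[OF v(1) ut[OF t] A(1)[OF t]] by simp
    ultimately have entry: "((\<lambda>s. (v * u s) $$ (i, j)) has_vector_derivative A t $$ (i, j)) (at t within {0..1})"
      if "i < n" "j < n" for i j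
      using mat_derivD(3)[OF _ t that] by fastforce
    have "((\<lambda>s. det (v * u s)) has_vector_derivative tr (A t)) (at t within {0..1})"
      by (rule det_has_derivative_at_one[OF mult_carrier_mat[OF v(1) ut] t v(2) A(1)[OF t] entry])
    then have "((\<lambda>s. det (u t) * det (v * u s)) has_vector_derivative det (u t) * tr (A t)) (at t within {0..1})"
      by (rule has_vector_derivative_mult_right)
    then have "((\<lambda>s. det (u s)) has_vector_derivative det (u t) * tr (A t)) (at t within {0..1})"
    proof (rule has_vector_derivative_transform[OF t, rotated])
      fix s :: real
      assume s: "s \<in> {0..1}"
      have "det (u t) * det (v * u s) = det (u t * (v * u s))"
        using ut[OF t] ut[OF s] v(1) by (simp add: det_mult[of _ n])
      also have "u t * (v * u s) = u s"
        using ut[OF t] ut[OF s] v by (simp flip: assoc_mult_mat[of _ n n _ n _ n])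
      finally show "det (u s) = det (u t) * det (v * u s)" by simp
    qed
    then show ?thesis
      using A(2)[OF t] by (simp add: has_vector_derivative_def)
  qed
  then obtain a where a: "\<forall>t\<in>{0..1}. det (u t) = a"
    using has_derivative_zero_constant[of "{0..1::real}" "\<lambda>t. det (u t)"] by auto
  then have "a = 1"
    using u(2) by force
  with a t show ?thesis by blast
qed

section \<open>Trace and Frobenius norm over the three scalar types\<close>

definition fro :: "'a :: real_normed_vector mat \<Rightarrow> real" where
  "fro A = (\<Sum>i<dim_row A. \<Sum>j<dim_col A. (norm (A $$ (i, j)))\<^sup>2)"

lemma fro_nonneg: "fro A \<ge> 0"
  by (auto simp: fro_def intro!: sum_nonneg)

lemma fro_eq_0_iff:
  fixes A :: "'a :: real_normed_algebra_1 mat"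
  assumes "A \<in> carrier_mat n m"
  shows "fro A = 0 \<longleftrightarrow> A = 0\<^sub>m n m"
proof
  assume "fro A = 0"
  then have "\<forall>i<n. \<forall>j<m. A $$ (i, j) = 0"
    using assms by (simp add: fro_def sum_nonneg_eq_0_iff sum_nonneg Ball_def)
  then show "A = 0\<^sub>m n m"
    using assms by (intro eq_matI) auto
qed (simp add: fro_def)

lemma fro_uminus: "fro (- A :: 'a :: real_normed_algebra_1 mat) = fro A"
  by (simp add: fro_def)

lemma fro_four_block:
  assumes "A \<in> carrier_mat n1 m1" "B \<in> carrier_mat n1 m2" "C \<in> carrier_mat n2 m1" "D \<in> carrier_mat n2 m2"
  shows "fro (four_block_mat A B C D) = fro A + fro B + fro C + fro D"
proof -
  have split: "(\<Sum>i<n + m. f i) = (\<Sum>i<n. f i) + (\<Sum>i<m. f (n + i))" for f :: "nat \<Rightarrow> real" and n m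
    by (induction m) (simp_all add: add.assoc)
  show ?thesis
    using assms by (simp add: fro_def split sum.distrib)
qed

lemma fro_zero [simp]: "fro (0\<^sub>m n m :: 'a :: real_normed_algebra_1 mat) = 0"
  by (simp add: fro_def)

lemma fro_double:
  fixes A :: "'a :: real_normed_algebra_1 mat"
  shows "fro (A + A) = 4 * fro A"
proof -
  have "(norm (x + x))\<^sup>2 = 4 * (norm x)\<^sup>2" for x :: 'a
    by (simp add: power_mult_distrib flip: scaleR_2)
  then show ?thesis
    by (simp add: fro_def sum_distrib_left)
qed

text \<open>\<open>re\<close> stands for the identity, \<open>Re\<close> or \<open>qre\<close>. It
  replaces scalar values wherever a trace has to be cyclic. That flows stay in the group is an
  assumption, \<open>grp_flow\<close>, relative to unitarity: over the two fields its proof is the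
  determinant argument, over the quaternions it is immediate.\<close>

locale classical =
  fixes re :: "'a :: {classical_scalar, banach} \<Rightarrow> real"
  assumes re_add: "re (x + y) = re x + re y"
    and re_mult_commute: "re (x * y) = re (y * x)"
    and re_star_mult_self: "re (star x * x) = (norm x)\<^sup>2"
    and star_scaleR: "star (c *\<^sub>R (x :: 'a)) = c *\<^sub>R star x"
    and norm_star: "norm (star (x :: 'a)) = norm x"
    and form_eq: "A \<in> skew_mats n \<Longrightarrow> form A A = - re (tr (A * A)) / 2"
    and grp_unitary: "(g :: 'a mat) \<in> grp n \<Longrightarrow> g \<in> unitary_mats n"
    and grp_mult: "(g :: 'a mat) \<in> grp n \<Longrightarrow> h \<in> grp n \<Longrightarrow> g * h \<in> grp n"
    and grp_adj: "(g :: 'a mat) \<in> grp n \<Longrightarrow> adj g \<in> grp n"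
    and grp_blk: "(g :: 'a mat) \<in> grp n \<Longrightarrow> blk q g \<in> grp (n + q)"
    and lie_skew: "(X :: 'a mat) \<in> lie n \<Longrightarrow> X \<in> skew_mats n"
    and lie_zero: "(0\<^sub>m n n :: 'a mat) \<in> lie n"
    and lie_add: "(X :: 'a mat) \<in> lie n \<Longrightarrow> Y \<in> lie n \<Longrightarrow> X + Y \<in> lie n"
    and lie_uminus: "(X :: 'a mat) \<in> lie n \<Longrightarrow> - X \<in> lie n"
    and lie_conj: "(X :: 'a mat) \<in> lie n \<Longrightarrow> g \<in> grp n \<Longrightarrow> g * X * adj g \<in> lie n"
    and grp_flow: "mat_deriv n n (u :: real \<Rightarrow> 'a mat) (\<lambda>t. u t * Z t) \<Longrightarrow> u 0 = 1\<^sub>m n \<Longrightarrow>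
      (\<And>t. t \<in> {0..1} \<Longrightarrow> Z t \<in> lie n) \<Longrightarrow> (\<And>t. t \<in> {0..1} \<Longrightarrow> u t \<in> unitary_mats n) \<Longrightarrow>
      t \<in> {0..1} \<Longrightarrow> u t \<in> grp n"
begin

text \<open>Not a simplification rule: interpreted by the identity it becomes \<open>0 = 0\<close>, which loops.\<close>

lemma re_zero: "re 0 = 0"
  using re_add[of 0 0] by simp

lemma re_uminus: "re (- x) = - re x"
  using re_add[of x "- x"] by (simp add: re_zero)

lemma re_sum: "re (sum f S) = (\<Sum>x\<in>S. re (f x))"
  by (induction S rule: infinite_finite_induct) (simp_all add: re_add re_zero)

text \<open>Over the quaternions the trace itself is not cyclic; commuting the entries is legitimate
  only under \<open>re\<close>.\<close>

lemma re_tr_mult_commute: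
  assumes "A \<in> carrier_mat n m" "B \<in> carrier_mat m n"
  shows "re (tr (A * B)) = re (tr (B * A))"
proof -
  have "re (tr (A * B)) = (\<Sum>i<n. \<Sum>j<m. re (A $$ (i, j) * B $$ (j, i)))"
    using assms by (simp add: tr_def index_mult_mat_sum[OF assms] re_sum del: index_mult_mat(1))
  also have "\<dots> = (\<Sum>i<n. \<Sum>j<m. re (B $$ (j, i) * A $$ (i, j)))"
    by (simp only: re_mult_commute)
  also have "\<dots> = (\<Sum>j<m. \<Sum>i<n. re (B $$ (j, i) * A $$ (i, j)))"
    by (rule sum.swap)
  also have "\<dots> = re (tr (B * A))"
    using assms by (simp add: tr_def index_mult_mat_sum[OF assms(2,1)] re_sum del: index_mult_mat(1))
  finally show ?thesis .
qed

lemma re_tr_uminus: "A \<in> carrier_mat n n \<Longrightarrow> re (tr (- A)) = - re (tr A)"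
  by (simp add: tr_def re_sum re_uminus flip: sum_negf)

lemma re_tr_add:
  "A \<in> carrier_mat n n \<Longrightarrow> B \<in> carrier_mat n n \<Longrightarrow> re (tr (A + B)) = re (tr A) + re (tr B)"
  by (simp add: tr_def re_sum re_add sum.distrib)

lemma re_tr_adj_mult_self:
  assumes "A \<in> carrier_mat n m"
  shows "re (tr (adj A * A)) = fro A"
proof -
  have "re (tr (adj A * A)) = (\<Sum>i<m. \<Sum>j<n. (norm (A $$ (j, i)))\<^sup>2)"
    using assms by (simp add: tr_def index_mult_mat_sum[OF adj_carrier[OF assms] assms] re_sum
        re_star_mult_self del: index_mult_mat(1))
  also have "\<dots> = fro A"
    using assms by (simp add: fro_def sum.swap[of _ "{..<m}"])
  finally show ?thesis .
qed

lemma fro_adj: "fro (adj A :: 'a mat) = fro A"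
  unfolding fro_def by (subst sum.swap) (simp add: norm_star)

lemma fro_isometry_mult:
  fixes g A :: "'a mat"
  assumes "g \<in> carrier_mat n m" "adj g * g = 1\<^sub>m m" "A \<in> carrier_mat m p"
  shows "fro (g * A) = fro A"
proof -
  have "adj (g * A) * (g * A) = adj A * (adj g * g) * A"
    using carrier_matD[OF assms(1)] carrier_matD[OF assms(3)] by (simp add: mat_dim_simps)
  then show ?thesis
    using assms re_tr_adj_mult_self[of A m p] re_tr_adj_mult_self[of "g * A" n p] by simp
qed

lemma fro_mult_coisometry:
  fixes g A :: "'a mat"
  assumes "A \<in> carrier_mat p m" "g \<in> carrier_mat m n" "g * adj g = 1\<^sub>m m"
  shows "fro (A * g) = fro A"
proof -
  have "fro (A * g) = fro (adj g * adj A)"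
    using fro_adj[of "A * g"] assms by (simp add: adj_mult[of _ p m])
  also have "\<dots> = fro (adj A)"
    by (rule fro_isometry_mult[of _ n m _ p]) (use assms in auto)
  finally show ?thesis by (simp add: fro_adj)
qed

text \<open>For skew \<open>X\<close> the trace of \<open>X * X\<close> is minus that of
  \<open>adj X * X\<close>. From here on the three trace forms with their different normalisations
  are one and the same expression.\<close>

lemma form_skew:
  fixes X :: "'a mat"
  assumes "X \<in> skew_mats n"
  shows "form X X = fro X / 2"
proof -
  have "fro X = re (tr (- X * X))"
    using re_tr_adj_mult_self[OF skew_matsD(1)[OF assms]] skew_matsD(2)[OF assms] by simp
  also have "- X * X = - (X * X)"
    using skew_matsD(1)[OF assms] by (intro uminus_mult_left_mat) auto
  finally show ?thesis
    using form_eq[OF assms] skew_matsD(1)[OF assms] by (simp add: re_tr_uminus[of _ n])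
qed

text \<open>Over the quaternions there is no determinant to invert with. If \<open>u * adj u = 1\<close>, then
  \<open>p = 1 - adj u * u\<close> is a self-adjoint idempotent, so \<open>fro p\<close> is the real part of its trace,
  which vanishes.\<close>

lemma unitary_of_right_inverse:
  fixes u :: "'a mat"
  assumes u: "u \<in> carrier_mat n n" and inv: "u * adj u = 1\<^sub>m n"
  shows "u \<in> unitary_mats n"
proof -
  define w where "w = adj u * u"
  define p where "p = 1\<^sub>m n + (- w)"
  have w: "w \<in> carrier_mat n n" and p: "p \<in> carrier_mat n n"
    using u by (auto simp: w_def p_def)
  have "w * w = adj u * (u * adj u) * u"
    unfolding w_def using carrier_matD[OF u] by (simp add: mat_dim_simps)
  then have ww: "w * w = w"
    using u by (simp add: inv w_def)
  have adj_p: "adj p = p"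
    using w u by (simp add: p_def adj_add[of _ n n] adj_uminus w_def adj_mult[of _ n n])
  have "w + - w = 0\<^sub>m n n"
    using w by (intro eq_matI) auto
  then have "p * w = 0\<^sub>m n n"
    using carrier_matD[OF w] w by (simp add: p_def mat_dim_simps ww)
  then have "p * p = p"
    using carrier_matD[OF w] carrier_matD[OF p] p
    by (subst (2) p_def) (simp add: mat_dim_simps)
  then have "adj p * p = p"
    unfolding adj_p .
  then have "fro p = re (tr p)"
    using re_tr_adj_mult_self[OF p] by simp
  also have "\<dots> = re (tr (1\<^sub>m n)) - re (tr (adj u * u))"
    using w u by (simp add: p_def re_tr_add[of _ n] re_tr_uminus[of _ n] w_def)
  also have "\<dots> = 0"
    using re_tr_mult_commute[OF adj_carrier[OF u] u] inv by simp
  finally have "p = 0\<^sub>m n n"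
    using fro_eq_0_iff[OF p] by simp
  then have "w = 1\<^sub>m n"
  proof (intro eq_matI)
    fix i j
    assume "i < dim_row (1\<^sub>m n :: 'a mat)" "j < dim_col (1\<^sub>m n :: 'a mat)"
    moreover have "p $$ (i, j) = 0\<^sub>m n n $$ (i, j)"
      using \<open>p = 0\<^sub>m n n\<close> by simp
    ultimately show "w $$ (i, j) = 1\<^sub>m n $$ (i, j)"
      using w by (simp add: p_def del: index_one_mat(1))
  qed (use w in auto)
  then show ?thesis
    using u inv by (simp add: unitary_mats_def w_def)
qed

lemma bounded_linear_star: "bounded_linear (star :: 'a \<Rightarrow> 'a)"
  by (rule bounded_linear_intro[of _ 1]) (simp_all add: star_add star_scaleR norm_star)

lemma mat_deriv_adj:
  fixes c :: "real \<Rightarrow> 'a mat"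
  assumes "mat_deriv n m c c'"
  shows "mat_deriv m n (\<lambda>t. adj (c t)) (\<lambda>t. adj (c' t))"
  unfolding mat_deriv_def
proof (intro conjI allI impI ballI)
  fix t :: real and i j
  assume t: "t \<in> {0..1}" and ij: "i < m" "j < n"
  note C = mat_derivD(1,2)[OF assms]
  have "((\<lambda>u. star (c u $$ (j, i))) has_vector_derivative star (c' t $$ (j, i))) (at t within {0..1})"
    by (rule bounded_linear.has_vector_derivative[OF bounded_linear_star mat_derivD(3)[OF assms t ij(2,1)]])
  also have "star (c' t $$ (j, i)) = adj (c' t) $$ (i, j)"
    using C[OF t] ij by simp
  finally show "((\<lambda>u. adj (c u) $$ (i, j)) has_vector_derivative adj (c' t) $$ (i, j)) (at t within {0..1})"
    by (rule has_vector_derivative_transform[OF t, rotated]) (use carrier_matD[OF C(1)] ij in simp)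
qed (use mat_derivD(1,2)[OF assms] in auto)

lemma mat_cont_adj:
  fixes c :: "real \<Rightarrow> 'a mat"
  assumes "mat_cont n m c"
  shows "mat_cont m n (\<lambda>t. adj (c t))"
  unfolding mat_cont_def
proof (intro conjI allI impI ballI)
  fix i j
  assume ij: "i < m" "j < n"
  then have "continuous_on {0..1} (\<lambda>t. star (c t $$ (j, i)))"
    using assms by (intro bounded_linear.continuous_on[OF bounded_linear_star]) (simp add: mat_cont_def)
  then show "continuous_on {0..1} (\<lambda>t. adj (c t) $$ (i, j))"
    by (rule continuous_on_eq) (use carrier_matD[OF mat_contD[OF assms]] ij in simp)
qed (use mat_contD[OF assms] in auto)

text \<open>In the derivative of \<open>u * adj u\<close> the generator appears between the two
  factors as \<open>adj A + A\<close>, which is 0, so the product is constant. The other order,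
  \<open>adj u * u\<close>, has no such cancellation; therefore only a right inverse is obtained
  directly and \<open>unitary_of_right_inverse\<close> has to supply the rest.\<close>

lemma grp_flow_exists:
  fixes A :: "real \<Rightarrow> 'a mat"
  assumes A: "mat_cont k k A" "\<And>t. t \<in> {0..1} \<Longrightarrow> A t \<in> lie k"
  obtains u where "mat_deriv k k u (\<lambda>t. u t * A t)" "\<And>t. t \<in> {0..1} \<Longrightarrow> u t \<in> grp k"
proof -
  obtain u where u: "mat_deriv k k u (\<lambda>t. u t * A t)" "u 0 = 1\<^sub>m k"
    using mat_ode_solution[OF A(1)] .
  have "mat_deriv k k (\<lambda>t. u t * adj (u t)) (\<lambda>t. u t * adj (u t * A t) + u t * A t * adj (u t))"
    by (rule mat_deriv_mult[OF u(1) mat_deriv_adj[OF u(1)]])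
  then have "mat_deriv k k (\<lambda>t. u t * adj (u t)) (\<lambda>_. 0\<^sub>m k k)"
  proof (rule mat_deriv_cong)
    fix t :: real
    assume t: "t \<in> {0..1}"
    note [simp] = carrier_matD[OF mat_derivD(1)[OF u(1) t]] carrier_matD[OF mat_contD[OF A(1) t]]
    have "u t * adj (u t * A t) = - (u t * A t * adj (u t))"
      using skew_matsD(2)[OF lie_skew[OF A(2)[OF t]]] by (simp add: mat_dim_simps)
    moreover have "u t * A t * adj (u t) \<in> carrier_mat k k"
      by auto
    ultimately show "0\<^sub>m k k = u t * adj (u t * A t) + u t * A t * adj (u t)"
      using uminus_l_inv_mat by metis
  qed simp
  then have "u t * adj (u t) = u 0 * adj (u 0)" if "t \<in> {0..1}" for t
    using mat_deriv_zero_imp_constant that by blast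
  then have unitary: "u t \<in> unitary_mats k" if "t \<in> {0..1}" for t
    using that mat_derivD(1)[OF u(1) that] by (intro unitary_of_right_inverse) (simp_all add: u(2))
  show ?thesis
    using that u(1) grp_flow[OF u A(2) unitary] by blast
qed

section \<open>The induced metrics\<close>

lemma grp_carrier: "(g :: 'a mat) \<in> grp n \<Longrightarrow> g \<in> carrier_mat n n"
  using grp_unitary unitary_matsD(1) by blast

lemma lie_carrier: "(X :: 'a mat) \<in> lie n \<Longrightarrow> X \<in> carrier_mat n n"
  using lie_skew skew_matsD(1) by blast

lemma fro_unitary_conj:
  assumes u: "u \<in> unitary_mats k" and A: "(A :: 'a mat) \<in> carrier_mat k k"
  shows "fro (u * A * adj u) = fro A"
proof -
  note U = unitary_matsD[OF u]
  have "fro (u * A * adj u) = fro (u * A)"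
    by (rule fro_mult_coisometry[OF mult_carrier_mat[OF U(1) A] adj_carrier[OF U(1)]]) (simp add: U(2))
  also have "\<dots> = fro A"
    by (rule fro_isometry_mult[OF U(1,2) A])
  finally show ?thesis .
qed

section \<open>Horizontal vectors and their length\<close>

text \<open>The first component of a vector in each of the three distributions; the quasi-geodesic
  one has \<open>A = 0\<close>. One computation of trace form and continuity thus serves them
  all.\<close>

definition hor :: "nat \<Rightarrow> 'a mat \<Rightarrow> 'a mat \<Rightarrow> 'a mat" where
  "hor q A B = four_block_mat A B (- adj B) (0\<^sub>m q q)"

lemma hor_carrier [simp, intro]: "A \<in> carrier_mat k k \<Longrightarrow> hor q A B \<in> carrier_mat (k + q) (k + q)"
  by (auto simp: hor_def)

lemma reduced_p_iff: "X \<in> reduced_p (k + q) k \<longleftrightarrow> (\<exists>A B. A \<in> lie k \<and> B \<in> carrier_mat k q \<and> X = hor q A B)"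
  by (auto simp: reduced_p_def hor_def)

lemma orthogonal_p_iff:
  "(X, Y) \<in> orthogonal_p (k + q) k \<longleftrightarrow>
    (\<exists>A B. A \<in> lie k \<and> B \<in> carrier_mat k q \<and> X = hor q A B \<and> Y = - A)"
  by (auto simp: orthogonal_p_def hor_def)

lemma quasi_geodesic_p_iff:
  "(X, Y) \<in> quasi_geodesic_p (k + q) k \<longleftrightarrow>
    Y \<in> lie k \<and> (\<exists>B. B \<in> carrier_mat k q \<and> X = hor q (0\<^sub>m k k) B)"
  by (auto simp: quasi_geodesic_p_def hor_def)

lemma form_lie: "(X :: 'a mat) \<in> lie n \<Longrightarrow> form X X = fro X / 2"
  using form_skew lie_skew by blast

text \<open>\<open>B\<close> occurs twice, once as \<open>- adj B\<close>, and so loses the factor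
  1/2 that \<open>A\<close> keeps.\<close>

lemma form_hor:
  assumes A: "A \<in> lie k" and B: "B \<in> carrier_mat k q"
  shows "form (hor q A B) (hor q A B) = fro A / 2 + fro B"
proof -
  note AC = lie_carrier[OF A]
  have "adj (hor q A B) = four_block_mat (- A) (- B) (adj B) (0\<^sub>m q q)"
    unfolding hor_def using A B AC skew_matsD(2)[OF lie_skew[OF A]]
    by (subst adj_four_block[of _ k k _ q _ q]) (auto simp: adj_uminus)
  also have "\<dots> = - hor q A B"
    unfolding hor_def using AC B by (intro eq_matI) auto
  finally have "hor q A B \<in> skew_mats (k + q)"
    using AC by (auto simp: skew_mats_def)
  then have "form (hor q A B) (hor q A B) = fro (hor q A B) / 2"
    by (rule form_skew)
  also have "fro (hor q A B) = fro A + 2 * fro B"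
    unfolding hor_def using AC B
    by (subst fro_four_block[of _ k k _ q _ q]) (auto simp: fro_uminus fro_adj)
  finally show ?thesis by simp
qed

lemma mat_cont_hor:
  assumes "mat_cont k k A" "mat_cont k q B"
  shows "mat_cont (k + q) (k + q) (\<lambda>t. hor q (A t) (B t))"
  unfolding hor_def
  by (intro mat_cont_four_block mat_cont_uminus mat_cont_adj mat_cont_const assms) auto

lemma mat_cont_hor_blocks:
  assumes "mat_cont (k + q) (k + q) (\<lambda>t. hor q (A t) (B t))"
    and A: "\<And>t. t \<in> {0..1} \<Longrightarrow> A t \<in> carrier_mat k k"
    and B: "\<And>t. t \<in> {0..1} \<Longrightarrow> B t \<in> carrier_mat k q"
  shows "mat_cont k k A" "mat_cont k q B"
proof -
  have cont: "continuous_on {0..1} (\<lambda>t. hor q (A t) (B t) $$ (i, j))" if "i < k + q" "j < k + q" for i j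
    using assms(1) that by (simp add: mat_cont_def)
  have "continuous_on {0..1} (\<lambda>t. A t $$ (i, j))" if "i < k" "j < k" for i j
    by (rule continuous_on_eq[OF cont[of i j]])
      (use that carrier_matD[OF A] in \<open>simp_all add: hor_def\<close>)
  moreover have "continuous_on {0..1} (\<lambda>t. B t $$ (i, j))" if "i < k" "j < q" for i j
    by (rule continuous_on_eq[OF cont[of i "k + j"]])
      (use that carrier_matD[OF A] in \<open>simp_all add: hor_def\<close>)
  ultimately show "mat_cont k k A" "mat_cont k q B"
    using A B by (auto simp: mat_cont_def)
qed

text \<open>The velocity of the block embedding of a curve \<open>u\<close> compensates exactly the upper left
  block of a horizontal vector: this is what turns reduced into quasi-geodesic lifts and back.\<close>

lemma hor_mult_blk:
  assumes A: "A \<in> skew_mats k" and B: "B \<in> carrier_mat k q" and u: "u \<in> unitary_mats k"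
    and A': "A' \<in> carrier_mat k k"
  shows "four_block_mat (adj (u * A')) (0\<^sub>m k q) (0\<^sub>m q k) (0\<^sub>m q q) + hor q A B * blk q (adj u)
    = blk q (adj u) * hor q (u * (A + adj A') * adj u) (u * B)"
proof -
  note [simp] = carrier_matD[OF skew_matsD(1)[OF A]] carrier_matD[OF B] carrier_matD[OF A']
    carrier_matD[OF unitary_matsD(1)[OF u]] unitary_matsD(2)[OF u]
  have "hor q A B * blk q (adj u) = four_block_mat (A * adj u) B (- adj B * adj u) (0\<^sub>m q q)"
    unfolding hor_def by (rule four_block_mult_blk[of _ k _ k]) (auto intro!: carrier_matI)
  then have "four_block_mat (adj (u * A')) (0\<^sub>m k q) (0\<^sub>m q k) (0\<^sub>m q q) + hor q A B * blk q (adj u)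
      = four_block_mat (adj A' * adj u + A * adj u) B (- adj B * adj u) (0\<^sub>m q q)"
    by (intro eq_matI) (auto simp: adj_mult_dim)
  also have "adj A' * adj u + A * adj u = A * adj u + adj A' * adj u"
    by (rule comm_add_mat[of _ k k]) auto
  also have "\<dots> = adj u * (u * (A + adj A') * adj u)"
    by (simp add: mat_dim_simps mat_mult_cancel_dim)
  also have "- adj B * adj u = - adj (u * B)"
    by (simp add: mat_dim_simps)
  also have "B = adj u * (u * B)"
    by (simp add: mat_mult_cancel_dim)
  finally show ?thesis
    unfolding hor_def
    by (subst blk_mult_four_block[of _ k _ k _ q _ q]) (auto intro!: carrier_matI simp: mat_mult_cancel_dim)
qed

section \<open>Conversion between reduced and quasi-geodesic lifts\<close>

text \<open>The block \<open>A\<close> of the given lift and the generator \<open>A'\<close> of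
  \<open>u\<close> are kept independent, so that both conversions are instances:
  \<open>A' = A\<close> makes the new upper left block vanish, and \<open>A = 0\<close> creates the
  block \<open>u * adj A' * adj u\<close>.\<close>

lemma has_velocity_mult_blk:
  assumes g: "mat_deriv (k + q) (k + q) g (\<lambda>t. g t * hor q (A t) (B t))"
    and u: "mat_deriv k k u (\<lambda>t. u t * A' t)" "\<And>t. t \<in> {0..1} \<Longrightarrow> u t \<in> unitary_mats k"
    and A: "mat_cont k k A" "\<And>t. t \<in> {0..1} \<Longrightarrow> A t \<in> skew_mats k"
    and B: "mat_cont k q B" and A': "mat_cont k k A'"
  shows "has_velocity (k + q) (\<lambda>t. g t * blk q (adj (u t))) (\<lambda>t. g t * blk q (adj (u t)) *
    hor q (u t * (A t + adj (A' t)) * adj (u t)) (u t * B t))"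
  unfolding has_velocity_iff
proof
  note adj_u = mat_deriv_adj[OF u(1)]
  note deriv = mat_deriv_mult[OF g mat_deriv_blk[OF adj_u, of q]]
  show "mat_deriv (k + q) (k + q) (\<lambda>t. g t * blk q (adj (u t))) (\<lambda>t. g t * blk q (adj (u t)) *
      hor q (u t * (A t + adj (A' t)) * adj (u t)) (u t * B t))"
  proof (rule mat_deriv_cong[OF deriv])
    fix t :: real
    assume t: "t \<in> {0..1}"
    note [simp] = carrier_matD[OF mat_derivD(1)[OF g t]] carrier_matD[OF mat_contD[OF A(1) t]]
      carrier_matD[OF mat_contD[OF B t]] carrier_matD[OF mat_contD[OF A' t]]
      carrier_matD[OF mat_derivD(1)[OF u(1) t]]
    have [simp]: "dim_row (blk q U) = dim_row U + q" "dim_col (blk q U) = dim_col U + q"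
      "dim_row (hor q U V) = dim_row U + q" "dim_col (hor q U V) = dim_col U + q" for U V :: "'a mat"
      by (simp_all add: blk_def hor_def)
    note eq = hor_mult_blk[OF A(2)[OF t] mat_contD[OF B t] u(2)[OF t] mat_contD[OF A' t]]
    have "g t * blk q (adj (u t)) * hor q (u t * (A t + adj (A' t)) * adj (u t)) (u t * B t) =
        g t * (blk q (adj (u t)) * hor q (u t * (A t + adj (A' t)) * adj (u t)) (u t * B t))"
      by (rule mat_mult_assoc_dim) simp_all
    also have "\<dots> = g t * four_block_mat (adj (u t * A' t)) (0\<^sub>m k q) (0\<^sub>m q k) (0\<^sub>m q q) +
        g t * (hor q (A t) (B t) * blk q (adj (u t)))"
      unfolding eq[symmetric] by (rule mat_mult_add_dim) simp_all
    also have "g t * (hor q (A t) (B t) * blk q (adj (u t))) = g t * hor q (A t) (B t) * blk q (adj (u t))"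
      by (rule mat_mult_assoc_dim[symmetric]) simp_all
    finally show "g t * blk q (adj (u t)) * hor q (u t * (A t + adj (A' t)) * adj (u t)) (u t * B t) =
        g t * four_block_mat (adj (u t * A' t)) (0\<^sub>m k q) (0\<^sub>m q k) (0\<^sub>m q q) +
        g t * hor q (A t) (B t) * blk q (adj (u t))" .
  qed simp
  show "mat_cont (k + q) (k + q) (\<lambda>t. g t * blk q (adj (u t)) *
      hor q (u t * (A t + adj (A' t)) * adj (u t)) (u t * B t))"
    by (intro mat_cont_mult[of _ "k + q"] mat_cont_hor mat_cont_mult[of _ k] mat_cont_add mat_cont_adj A(1) A' B
        mat_deriv_imp_cont[OF deriv] mat_deriv_imp_cont[OF u(1)])
qed

lemma has_velocity_cong:
  assumes "has_velocity n (c :: real \<Rightarrow> 'a mat) c'" "\<And>t. t \<in> {0..1} \<Longrightarrow> d' t = c' t"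
  shows "has_velocity n c d'"
  using assms mat_deriv_cong[of n n c c' c d'] mat_cont_cong[of n n c' d']
  unfolding has_velocity_iff by blast

text \<open>A horizontal curve only comes with continuity of \<open>g t * X t\<close>. Multiplying
  by \<open>adj (g t)\<close> gives continuity of \<open>X\<close>, hence of its blocks, and a
  continuous \<open>A\<close> is what the flow equation requires.\<close>

lemma reduced_horizontalE:
  assumes hor: "horizontal (k + q) (reduced_p (k + q) k) g X"
  obtains A B where "mat_cont k k A" "mat_cont k q B"
    "\<forall>t\<in>{0..1}. A t \<in> lie k \<and> X t = hor q (A t) (B t) \<and> g t \<in> grp (k + q)"
    "mat_deriv (k + q) (k + q) g (\<lambda>t. g t * hor q (A t) (B t))"
proof -
  have g: "\<And>t. t \<in> {0..1} \<Longrightarrow> g t \<in> grp (k + q)"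
    and deriv: "mat_deriv (k + q) (k + q) g (\<lambda>t. g t * X t)"
    and cont: "mat_cont (k + q) (k + q) (\<lambda>t. g t * X t)"
    and "\<forall>t\<in>{0..1}. \<exists>A B. A \<in> lie k \<and> B \<in> carrier_mat k q \<and> X t = hor q A B"
    using hor by (auto simp: horizontal_def has_velocity_iff reduced_p_iff)
  then obtain A B where AB: "\<And>t. t \<in> {0..1} \<Longrightarrow> A t \<in> lie k"
    "\<And>t. t \<in> {0..1} \<Longrightarrow> B t \<in> carrier_mat k q" "\<And>t. t \<in> {0..1} \<Longrightarrow> X t = hor q (A t) (B t)"
    by metis
  note carrier = lie_carrier[OF AB(1)]
  have "mat_cont (k + q) (k + q) (\<lambda>t. hor q (A t) (B t))"
  proof (rule mat_cont_cong[OF mat_cont_mult[OF mat_cont_adj[OF mat_deriv_imp_cont[OF deriv]] cont]])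
    fix t :: real
    assume t: "t \<in> {0..1}"
    note G = unitary_matsD[OF grp_unitary[OF g[OF t]]] and H = hor_carrier[OF carrier[OF t]]
    have "dim_row (hor q (A t) (B t)) = k + q"
      using H by blast
    then show "hor q (A t) (B t) = adj (g t) * (g t * X t)"
      using G AB(3)[OF t] by (simp add: mat_mult_cancel_dim carrier_matD[OF G(1)])
  qed
  then have "mat_cont k k A" "mat_cont k q B"
    using mat_cont_hor_blocks carrier AB(2) by blast+
  moreover have "mat_deriv (k + q) (k + q) g (\<lambda>t. g t * hor q (A t) (B t))"
    by (rule mat_deriv_cong[OF deriv]) (simp_all add: AB)
  ultimately show ?thesis
    using that AB g by blast
qed

text \<open>Continuity of \<open>B\<close> and of \<open>Y\<close> is recovered by multiplying the
  two velocities by \<open>adj (r t)\<close> and \<open>adj (s t)\<close>.\<close>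

lemma quasi_geodesic_horizontalE:
  assumes hor: "horizontal2 (k + q) k (quasi_geodesic_p (k + q) k) r s X Y"
  obtains B where "mat_cont k k Y" "mat_cont k q B"
    "\<forall>t\<in>{0..1}. Y t \<in> lie k \<and> X t = hor q (0\<^sub>m k k) (B t) \<and> r t \<in> grp (k + q) \<and> s t \<in> grp k"
    "mat_deriv (k + q) (k + q) r (\<lambda>t. r t * hor q (0\<^sub>m k k) (B t))"
    "mat_deriv k k s (\<lambda>t. s t * Y t)"
proof -
  have rs: "\<And>t. t \<in> {0..1} \<Longrightarrow> r t \<in> grp (k + q)" "\<And>t. t \<in> {0..1} \<Longrightarrow> s t \<in> grp k"
    and r: "mat_deriv (k + q) (k + q) r (\<lambda>t. r t * X t)" "mat_cont (k + q) (k + q) (\<lambda>t. r t * X t)"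
    and s: "mat_deriv k k s (\<lambda>t. s t * Y t)" "mat_cont k k (\<lambda>t. s t * Y t)"
    and Y: "\<And>t. t \<in> {0..1} \<Longrightarrow> Y t \<in> lie k"
    and "\<forall>t\<in>{0..1}. \<exists>B. B \<in> carrier_mat k q \<and> X t = hor q (0\<^sub>m k k) B"
    using hor by (auto simp: horizontal2_def has_velocity_iff quasi_geodesic_p_iff)
  then obtain B where B: "\<And>t. t \<in> {0..1} \<Longrightarrow> B t \<in> carrier_mat k q"
    "\<And>t. t \<in> {0..1} \<Longrightarrow> X t = hor q (0\<^sub>m k k) (B t)"
    by metis
  have "mat_cont (k + q) (k + q) (\<lambda>t. hor q (0\<^sub>m k k) (B t))"
  proof (rule mat_cont_cong[OF mat_cont_mult[OF mat_cont_adj[OF mat_deriv_imp_cont[OF r(1)]] r(2)]])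
    fix t :: real
    assume t: "t \<in> {0..1}"
    note G = unitary_matsD[OF grp_unitary[OF rs(1)[OF t]]]
    show "hor q (0\<^sub>m k k) (B t) = adj (r t) * (r t * X t)"
      using G B(2)[OF t] carrier_matD[OF hor_carrier[of "0\<^sub>m k k" k q "B t"]]
      by (simp add: mat_mult_cancel_dim carrier_matD[OF G(1)])
  qed
  then have "mat_cont k q B"
    using mat_cont_hor_blocks(2)[of k q "\<lambda>_. 0\<^sub>m k k" B] B(1) by simp
  moreover have "mat_cont k k Y"
  proof (rule mat_cont_cong[OF mat_cont_mult[OF mat_cont_adj[OF mat_deriv_imp_cont[OF s(1)]] s(2)]])
    fix t :: real
    assume t: "t \<in> {0..1}"
    note G = unitary_matsD[OF grp_unitary[OF rs(2)[OF t]]]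
    show "Y t = adj (s t) * (s t * Y t)"
      using G carrier_matD[OF lie_carrier[OF Y[OF t]]] by (simp add: mat_mult_cancel_dim carrier_matD[OF G(1)])
  qed
  moreover have "mat_deriv (k + q) (k + q) r (\<lambda>t. r t * hor q (0\<^sub>m k k) (B t))"
    by (rule mat_deriv_cong[OF r(1)]) (simp_all add: B)
  ultimately show ?thesis
    using that B Y rs s by blast
qed

lemma base_point_transfer:
  assumes "g \<in> carrier_mat (k + q) (k + q)" "u \<in> carrier_mat k k"
  shows "g * blk q u * base_point (k + q) k = g * base_point (k + q) k * (u :: 'a mat)"
proof -
  have "g * blk q u * base_point (k + q) k = g * (base_point (k + q) k * u)"
    using assms by (simp add: assoc_mult_mat[of _ "k + q" "k + q" _ "k + q" _ k] flip: blk_mult_base_point)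
  then show ?thesis
    using assms by (simp add: assoc_mult_mat[of _ "k + q" "k + q" _ k _ k])
qed

lemma reduced_to_quasi_geodesic_lift:
  fixes g X :: "real \<Rightarrow> 'a mat"
  assumes "horizontal (k + q) (reduced_p (k + q) k) g X"
  obtains r s X' Y' where "horizontal2 (k + q) k (quasi_geodesic_p (k + q) k) r s X' Y'"
    "\<And>t. t \<in> {0..1} \<Longrightarrow> r t * base_point (k + q) k * adj (s t) = g t * base_point (k + q) k"
    "sr_length2 X' Y' = sr_length X"
proof -
  obtain A B where Ac: "mat_cont k k A" and B: "mat_cont k q B"
    and *: "\<forall>t\<in>{0..1}. A t \<in> lie k \<and> X t = hor q (A t) (B t) \<and> g t \<in> grp (k + q)"
    and gd: "mat_deriv (k + q) (k + q) g (\<lambda>t. g t * hor q (A t) (B t))"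
    using reduced_horizontalE[OF assms] .
  have A: "mat_cont k k A" "\<And>t. t \<in> {0..1} \<Longrightarrow> A t \<in> lie k" and X: "\<And>t. t \<in> {0..1} \<Longrightarrow> X t = hor q (A t) (B t)"
    and g: "\<And>t. t \<in> {0..1} \<Longrightarrow> g t \<in> grp (k + q)" "mat_deriv (k + q) (k + q) g (\<lambda>t. g t * hor q (A t) (B t))"
    using Ac * gd by simp_all
  obtain u where u: "mat_deriv k k u (\<lambda>t. u t * A t)" "\<And>t. t \<in> {0..1} \<Longrightarrow> u t \<in> grp k"
    using grp_flow_exists[OF A] by blast
  define r where "r t = g t * blk q (adj (u t))" for t
  define s where "s t = adj (u t)" for t
  define X' where "X' t = hor q (0\<^sub>m k k) (u t * B t)" for t
  \<comment> \<open>Forced by the choice of \<open>s\<close>: its velocity is (u A)* = - A u*, and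
    factoring out u* on the left leaves - u A u*.\<close>
  define Y' where "Y' t = - (u t * A t * adj (u t))" for t
  have dims [simp]: "dim_row (A t) = k" "dim_col (A t) = k" "dim_row (u t) = k" "dim_col (u t) = k"
    "dim_row (B t) = k" "dim_col (B t) = q" "adj (A t) = - A t" "adj (u t) * u t = 1\<^sub>m k"
    if "t \<in> {0..1}" for t
    using that mat_contD[OF A(1) that] mat_contD[OF B that] mat_derivD(1)[OF u(1) that]
      skew_matsD(2)[OF lie_skew[OF A(2)[OF that]]] unitary_matsD[OF grp_unitary[OF u(2)[OF that]]] by auto
  note uA = lie_conj[OF A(2) u(2)]
  have "has_velocity (k + q) r (\<lambda>t. r t * X' t)"
  proof -
    have *: "has_velocity (k + q) r (\<lambda>t. r t * hor q (u t * (A t + adj (A t)) * adj (u t)) (u t * B t))"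
      unfolding r_def
      by (rule has_velocity_mult_blk[OF g(2) u(1) grp_unitary[OF u(2)] A(1) lie_skew[OF A(2)] B A(1)])
    have "u t * (A t + adj (A t)) * adj (u t) = 0\<^sub>m k k" if t: "t \<in> {0..1}" for t
    proof -
      have "A t + - A t = 0\<^sub>m k k"
        using t by (intro eq_matI) auto
      then show ?thesis
        using t by simp
    qed
    then have "r t * X' t = r t * hor q (u t * (A t + adj (A t)) * adj (u t)) (u t * B t)"
      if "t \<in> {0..1}" for t
      using that by (simp add: X'_def)
    with * show ?thesis
      by (rule has_velocity_cong)
  qed
  moreover have "has_velocity k s (\<lambda>t. s t * Y' t)"
  proof -
    have *: "s t * Y' t = adj (u t * A t)" if "t \<in> {0..1}" for t
      using that by (simp add: s_def Y'_def mat_dim_simps mat_mult_cancel_dim)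
    show ?thesis
      unfolding has_velocity_iff
    proof
      show "mat_deriv k k s (\<lambda>t. s t * Y' t)"
        by (rule mat_deriv_cong[OF mat_deriv_adj[OF u(1)]]) (use * in \<open>simp_all add: s_def\<close>)
      show "mat_cont k k (\<lambda>t. s t * Y' t)"
        by (rule mat_cont_cong[OF mat_cont_adj[OF mat_cont_mult[OF mat_deriv_imp_cont[OF u(1)] A(1)]] *])
    qed
  qed
  moreover have "r t \<in> grp (k + q)" "s t \<in> grp k" "(X' t, Y' t) \<in> quasi_geodesic_p (k + q) k"
    if t: "t \<in> {0..1}" for t
    using grp_mult[OF g(1)[OF t] grp_blk[OF grp_adj[OF u(2)[OF t]]]] grp_adj[OF u(2)[OF t]]
      lie_uminus[OF uA[OF t t]] mult_carrier_mat[OF mat_derivD(1)[OF u(1) t] mat_contD[OF B t]]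
    by (auto simp: r_def s_def quasi_geodesic_p_iff X'_def Y'_def)
  ultimately have "horizontal2 (k + q) k (quasi_geodesic_p (k + q) k) r s X' Y'"
    by (auto simp: horizontal2_def)
  moreover have "r t * base_point (k + q) k * adj (s t) = g t * base_point (k + q) k" if t: "t \<in> {0..1}" for t
  proof -
    note G = grp_carrier[OF g(1)[OF t]]
    \<comment> \<open>The factor u* of \<open>r\<close> passes through the base point, where
      \<open>adj (s t)\<close>, which is \<open>u t\<close>, cancels it.\<close>
    have "r t * base_point (k + q) k * adj (s t) = g t * base_point (k + q) k * adj (u t) * u t"
      using base_point_transfer[OF G adj_carrier[OF mat_derivD(1)[OF u(1) t]]] by (simp add: r_def s_def)
    also have "\<dots> = g t * base_point (k + q) k"
      using t carrier_matD[OF G] carrier_matD[OF base_point_carrier[of "k + q" k, where ?'a='a]]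
      by (simp add: mat_mult_assoc_dim)
    finally show ?thesis .
  qed
  moreover have "sr_length2 X' Y' = sr_length X"
    unfolding sr_length2_def sr_length_def
  proof (intro integral_cong arg_cong[of _ _ sqrt])
    fix t :: real
    assume t: "t \<in> {0..1}"
    note U = unitary_matsD[OF grp_unitary[OF u(2)[OF t]]] and At = mat_contD[OF A(1) t]
      and Bt = mat_contD[OF B t]
    have "fro (u t * A t * adj (u t)) = fro (A t)"
      by (rule fro_unitary_conj[OF grp_unitary[OF u(2)[OF t]] At])
    moreover have "fro (u t * B t) = fro (B t)"
      by (rule fro_isometry_mult[OF U(1,2) Bt])
    ultimately show "form (X' t) (X' t) + form (Y' t) (Y' t) = form (X t) (X t)"
      using form_hor[OF lie_zero mult_carrier_mat[OF U(1) Bt]] form_hor[OF A(2)[OF t] Bt]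
        form_lie[OF lie_uminus[OF uA[OF t t]]] t
      by (simp add: X'_def Y'_def X fro_uminus)
  qed
  ultimately show ?thesis
    by (rule that)
qed

lemma quasi_geodesic_to_reduced_lift:
  fixes r s X Y :: "real \<Rightarrow> 'a mat"
  assumes "horizontal2 (k + q) k (quasi_geodesic_p (k + q) k) r s X Y"
  obtains g X' where "horizontal (k + q) (reduced_p (k + q) k) g X'"
    "\<And>t. t \<in> {0..1} \<Longrightarrow> g t * base_point (k + q) k = r t * base_point (k + q) k * adj (s t)"
    "sr_length X' = sr_length2 X Y"
proof -
  obtain B where Yc: "mat_cont k k Y" and B: "mat_cont k q B"
    and *: "\<forall>t\<in>{0..1}. Y t \<in> lie k \<and> X t = hor q (0\<^sub>m k k) (B t) \<and> r t \<in> grp (k + q) \<and> s t \<in> grp k"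
    and rd: "mat_deriv (k + q) (k + q) r (\<lambda>t. r t * hor q (0\<^sub>m k k) (B t))"
    and sd: "mat_deriv k k s (\<lambda>t. s t * Y t)"
    using quasi_geodesic_horizontalE[OF assms] .
  have Y: "mat_cont k k Y" "\<And>t. t \<in> {0..1} \<Longrightarrow> Y t \<in> lie k"
    and X: "\<And>t. t \<in> {0..1} \<Longrightarrow> X t = hor q (0\<^sub>m k k) (B t)"
    and r: "\<And>t. t \<in> {0..1} \<Longrightarrow> r t \<in> grp (k + q)"
      "mat_deriv (k + q) (k + q) r (\<lambda>t. r t * hor q (0\<^sub>m k k) (B t))"
    and s: "\<And>t. t \<in> {0..1} \<Longrightarrow> s t \<in> grp k" "mat_deriv k k s (\<lambda>t. s t * Y t)"
    using Yc * rd sd by simp_all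
  \<comment> \<open>No equation has to be solved in this direction: \<open>s\<close> is already a
    flow, generated by \<open>Y\<close>, and takes the part of \<open>u\<close>. The new block
    \<open>A\<close> is \<open>adj (Y t)\<close>, that is \<open>- Y t\<close>, conjugated by
    \<open>s t\<close>.\<close>
  define g where "g t = r t * blk q (adj (s t))" for t
  define A where "A t = - (s t * Y t * adj (s t))" for t
  define X' where "X' t = hor q (A t) (s t * B t)" for t
  have A: "A t \<in> lie k" if t: "t \<in> {0..1}" for t
    unfolding A_def by (rule lie_uminus[OF lie_conj[OF Y(2)[OF t] s(1)[OF t]]])
  have "has_velocity (k + q) g (\<lambda>t. g t * X' t)"
  proof -
    have *: "has_velocity (k + q) g (\<lambda>t. g t * hor q (s t * (0\<^sub>m k k + adj (Y t)) * adj (s t)) (s t * B t))"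
      unfolding g_def
      by (rule has_velocity_mult_blk[OF r(2) s(2) grp_unitary[OF s(1)] mat_cont_const[OF zero_carrier_mat]
            lie_skew[OF lie_zero] B Y(1)])
    have "s t * (0\<^sub>m k k + adj (Y t)) * adj (s t) = A t" if t: "t \<in> {0..1}" for t
      using skew_matsD[OF lie_skew[OF Y(2)[OF t]]] carrier_matD[OF mat_derivD(1)[OF s(2) t]]
      by (simp add: A_def mat_dim_simps carrier_matD)
    then have "g t * X' t = g t * hor q (s t * (0\<^sub>m k k + adj (Y t)) * adj (s t)) (s t * B t)"
      if "t \<in> {0..1}" for t
      using that by (simp add: X'_def)
    with * show ?thesis
      by (rule has_velocity_cong)
  qed
  moreover have "g t \<in> grp (k + q)" "X' t \<in> reduced_p (k + q) k" if t: "t \<in> {0..1}" for t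
  proof -
    show "g t \<in> grp (k + q)"
      unfolding g_def by (rule grp_mult[OF r(1)[OF t] grp_blk[OF grp_adj[OF s(1)[OF t]]]])
    show "X' t \<in> reduced_p (k + q) k"
      unfolding reduced_p_iff X'_def
      by (rule exI[of _ "A t"], rule exI[of _ "s t * B t"])
        (intro conjI refl A[OF t] mult_carrier_mat[OF mat_derivD(1)[OF s(2) t] mat_contD[OF B t]])
  qed
  ultimately have "horizontal (k + q) (reduced_p (k + q) k) g X'"
    by (auto simp: horizontal_def)
  moreover have "g t * base_point (k + q) k = r t * base_point (k + q) k * adj (s t)" if t: "t \<in> {0..1}" for t
    unfolding g_def
    by (rule base_point_transfer[OF grp_carrier[OF r(1)[OF t]] adj_carrier[OF mat_derivD(1)[OF s(2) t]]])
  moreover have "sr_length X' = sr_length2 X Y"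
    unfolding sr_length2_def sr_length_def
  proof (intro integral_cong arg_cong[of _ _ sqrt])
    fix t :: real
    assume t: "t \<in> {0..1}"
    note U = unitary_matsD[OF grp_unitary[OF s(1)[OF t]]] and Yt = mat_contD[OF Y(1) t]
      and Bt = mat_contD[OF B t]
    have "fro (s t * Y t * adj (s t)) = fro (Y t)"
      by (rule fro_unitary_conj[OF grp_unitary[OF s(1)[OF t]] Yt])
    moreover have "fro (s t * B t) = fro (B t)"
      by (rule fro_isometry_mult[OF U(1,2) Bt])
    ultimately show "form (X' t) (X' t) = form (X t) (X t) + form (Y t) (Y t)"
      using form_hor[OF lie_zero Bt] form_hor[OF A[OF t] mult_carrier_mat[OF U(1) Bt]]
        form_lie[OF Y(2)[OF t]] t
      by (simp add: X'_def A_def X fro_uminus)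
  qed
  ultimately show ?thesis
    by (rule that)
qed

lemma reduced_metric_eq_quasi_geodesic_metric:
  "(reduced_metric (k + q) k :: 'a curve_metric) = quasi_geodesic_metric (k + q) k"
proof (rule ext, rule Set.set_eqI)
  fix m :: "real \<Rightarrow> 'a mat" and L
  show "L \<in> reduced_metric (k + q) k m \<longleftrightarrow> L \<in> quasi_geodesic_metric (k + q) k m"
  proof
    assume "L \<in> reduced_metric (k + q) k m"
    then obtain g X where *: "\<forall>t\<in>{0..1}. m t \<in> stiefel (k + q) k"
      "horizontal (k + q) (reduced_p (k + q) k) g X"
      "\<forall>t\<in>{0..1}. g t * base_point (k + q) k = m t" "L = sr_length X"
      unfolding reduced_metric_def by blast
    obtain r s X' Y' where "horizontal2 (k + q) k (quasi_geodesic_p (k + q) k) r s X' Y'"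
      "\<And>t. t \<in> {0..1} \<Longrightarrow> r t * base_point (k + q) k * adj (s t) = g t * base_point (k + q) k"
      "sr_length2 X' Y' = sr_length X"
      using reduced_to_quasi_geodesic_lift[OF *(2)] by metis
    with * show "L \<in> quasi_geodesic_metric (k + q) k m"
      unfolding full_metric_def by force
  next
    assume "L \<in> quasi_geodesic_metric (k + q) k m"
    then obtain r s X Y where *: "\<forall>t\<in>{0..1}. m t \<in> stiefel (k + q) k"
      "horizontal2 (k + q) k (quasi_geodesic_p (k + q) k) r s X Y"
      "\<forall>t\<in>{0..1}. r t * base_point (k + q) k * adj (s t) = m t" "L = sr_length2 X Y"
      unfolding full_metric_def by blast
    obtain g X' where "horizontal (k + q) (reduced_p (k + q) k) g X'"
      "\<And>t. t \<in> {0..1} \<Longrightarrow> g t * base_point (k + q) k = r t * base_point (k + q) k * adj (s t)"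
      "sr_length X' = sr_length2 X Y"
      using quasi_geodesic_to_reduced_lift[OF *(2)] by metis
    with * show "L \<in> reduced_metric (k + q) k m"
      unfolding reduced_metric_def by force
  qed
qed

section \<open>The speed of a lift in terms of the projected curve\<close>

lemma hor_mult_base_point:
  assumes "A \<in> carrier_mat k k" "B \<in> carrier_mat k q"
  shows "hor q A B * base_point (k + q) k = four_block_mat A (0\<^sub>m k 0) (- adj B) (0\<^sub>m q 0)"
  unfolding hor_def by (rule four_block_mult_base_point) (use assms in auto)

lemma base_point_mult:
  assumes "(A :: 'a mat) \<in> carrier_mat k k"
  shows "base_point (k + q) k * A = four_block_mat A (0\<^sub>m k 0) (0\<^sub>m q k) (0\<^sub>m q 0)"
  unfolding blk_mult_base_point[OF assms, symmetric] blk_def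
  by (rule four_block_mult_base_point[THEN trans]) (use assms in auto)

lemma fro_tall:
  assumes "A \<in> carrier_mat k k" "(B :: 'a mat) \<in> carrier_mat k q"
  shows "fro (four_block_mat A (0\<^sub>m k 0) (- adj B) (0\<^sub>m q 0)) = fro A + fro B"
  using assms by (subst fro_four_block[of _ k k _ 0 _ q]) (auto simp: fro_uminus fro_adj)

text \<open>The speed of a lift is expressed through the projected curve \<open>m\<close> and its velocity alone,
  so all lifts of a given curve have the same length.\<close>

lemma reduced_speed:
  fixes g X m :: "real \<Rightarrow> 'a mat"
  assumes hor: "horizontal (k + q) (reduced_p (k + q) k) g X"
    and m: "\<And>t. t \<in> {0..1} \<Longrightarrow> g t * base_point (k + q) k = m t" "mat_deriv (k + q) k m m'"
    and t: "t \<in> {0..1}"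
  shows "form (X t) (X t) = fro (m' t) - fro (adj (m t) * m' t) / 2"
proof -
  obtain A B where AB: "A \<in> lie k" "B \<in> carrier_mat k q" "X t = hor q A B"
    using hor t unfolding horizontal_def reduced_p_iff by metis
  note Ac = lie_carrier[OF AB(1)]
  have G: "g t \<in> unitary_mats (k + q)"
    using hor t grp_unitary by (auto simp: horizontal_def)
  note U = unitary_matsD[OF G]
  define Z where "Z = four_block_mat A (0\<^sub>m k 0) (- adj B) (0\<^sub>m q 0)"
  have Z: "Z \<in> carrier_mat (k + q) k"
    using four_block_carrier_mat[OF Ac zero_carrier_mat[of q 0], of "0\<^sub>m k 0" "- adj B"] by (simp add: Z_def)
  have XZ: "X t * base_point (k + q) k = Z"
    unfolding AB(3) Z_def by (rule hor_mult_base_point[OF Ac AB(2)])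
  have deriv: "mat_deriv (k + q) (k + q) g (\<lambda>t. g t * X t)"
    using hor unfolding horizontal_def has_velocity_iff by blast
  have "mat_deriv (k + q) k m (\<lambda>t. g t * X t * base_point (k + q) k)"
    by (rule mat_deriv_cong[OF mat_deriv_mult_const[OF deriv base_point_carrier]]) (simp_all add: m(1))
  then have "m' t = g t * X t * base_point (k + q) k"
    using mat_deriv_unique[OF m(2) _ t] by auto
  also have "\<dots> = g t * Z"
    unfolding XZ[symmetric] using U(1) AB(3) hor_carrier[OF Ac, of q B]
    by (intro assoc_mult_mat[of _ "k + q" "k + q" _ "k + q" _ k]) auto
  finally have m': "m' t = g t * Z" .
  have "adj (m t) * m' t = adj (base_point (k + q) k) * Z"
    unfolding m' m(1)[OF t, symmetric]
    using U carrier_matD[OF U(1)] carrier_matD[OF Z] carrier_matD[OF base_point_carrier[of "k + q" k, where ?'a='a]]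
    by (simp add: mat_dim_simps mat_mult_cancel_dim)
  also have "\<dots> = A"
    unfolding Z_def using Ac AB(2) by (intro adj_base_point_mult) auto
  finally have 1: "adj (m t) * m' t = A" .
  have "fro (m' t) = fro A + fro B"
    unfolding m' fro_isometry_mult[OF U(1,2) Z] unfolding Z_def by (rule fro_tall[OF Ac AB(2)])
  with 1 show ?thesis
    using form_hor[OF AB(1,2)] AB(3) by simp
qed

lemma orthogonal_speed:
  fixes r s X Y m :: "real \<Rightarrow> 'a mat"
  assumes hor: "horizontal2 (k + q) k (orthogonal_p (k + q) k) r s X Y"
    and m: "\<And>t. t \<in> {0..1} \<Longrightarrow> r t * base_point (k + q) k * adj (s t) = m t" "mat_deriv (k + q) k m m'"
    and t: "t \<in> {0..1}"
  shows "form (X t) (X t) + form (Y t) (Y t) = fro (m' t) - 3 / 4 * fro (adj (m t) * m' t)"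
proof -
  obtain A B where AB: "A \<in> lie k" "B \<in> carrier_mat k q" "X t = hor q A B" "Y t = - A"
    using hor t unfolding horizontal2_def orthogonal_p_iff by metis
  note Ac = lie_carrier[OF AB(1)]
  have rs: "r t \<in> unitary_mats (k + q)" "s t \<in> unitary_mats k"
    using hor t grp_unitary by (auto simp: horizontal2_def)
  note R = unitary_matsD[OF rs(1)] and S = unitary_matsD[OF rs(2)]
  note [simp] = carrier_matD[OF R(1)] carrier_matD[OF S(1)] carrier_matD[OF Ac] R(2) S(2)
    carrier_matD[OF base_point_carrier[of "k + q" k, where ?'a='a]] carrier_matD[OF hor_carrier[OF Ac]]
  define Z where "Z = four_block_mat (A + A) (0\<^sub>m k 0) (- adj B) (0\<^sub>m q 0)"
  have Z: "Z \<in> carrier_mat (k + q) k"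
    using four_block_carrier_mat[OF add_carrier_mat[OF Ac, of A] zero_carrier_mat[of q 0], of "0\<^sub>m k 0" "- adj B"]
    by (simp add: Z_def)
  note [simp] = carrier_matD[OF Z]
  have XZ: "base_point (k + q) k * A + X t * base_point (k + q) k = Z"
    unfolding AB(3) Z_def base_point_mult[OF Ac] hor_mult_base_point[OF Ac AB(2)]
    using Ac AB(2) by (intro eq_matI) auto
  have deriv: "mat_deriv (k + q) (k + q) r (\<lambda>t. r t * X t)" "mat_deriv k k s (\<lambda>t. s t * Y t)"
    using hor unfolding horizontal2_def has_velocity_iff by blast+
  have "mat_deriv (k + q) k m (\<lambda>t. r t * base_point (k + q) k * adj (s t * Y t)
      + r t * X t * base_point (k + q) k * adj (s t))"
    by (rule mat_deriv_cong[OF mat_deriv_mult[OF mat_deriv_mult_const[OF deriv(1) base_point_carrier] mat_deriv_adj[OF deriv(2)]]])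
      (simp_all add: m(1))
  then have "m' t = r t * base_point (k + q) k * adj (s t * Y t) + r t * X t * base_point (k + q) k * adj (s t)"
    using mat_deriv_unique[OF m(2) _ t] by auto
  also have "adj (s t * Y t) = A * adj (s t)"
    using skew_matsD(2)[OF lie_skew[OF AB(1)]]
    by (simp add: AB(4) mat_dim_simps adj_uminus)
  also have "r t * base_point (k + q) k * (A * adj (s t)) + r t * X t * base_point (k + q) k * adj (s t)
      = r t * (Z * adj (s t))"
    unfolding XZ[symmetric] by (simp add: AB(3) mat_dim_simps)
  finally have m': "m' t = r t * (Z * adj (s t))" .
  have "adj (m t) * m' t = s t * (adj (base_point (k + q) k) * Z) * adj (s t)"
    unfolding m' m(1)[OF t, symmetric]
    by (simp add: mat_dim_simps mat_mult_cancel_dim)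
  also have "adj (base_point (k + q) k) * Z = A + A"
    unfolding Z_def using Ac AB(2) by (intro adj_base_point_mult) auto
  finally have "fro (adj (m t) * m' t) = fro (s t * (A + A) * adj (s t))" by simp
  also have "\<dots> = 4 * fro A"
    using fro_unitary_conj[OF rs(2) add_carrier_mat[OF Ac, of A]] by (simp add: fro_double)
  finally have 1: "fro (adj (m t) * m' t) = 4 * fro A" .
  have "fro (m' t) = fro (Z * adj (s t))"
    unfolding m' by (rule fro_isometry_mult[OF R(1,2) mult_carrier_mat[OF Z adj_carrier[OF S(1)]]])
  also have "\<dots> = fro Z"
    by (rule fro_mult_coisometry[OF Z adj_carrier[OF S(1)]]) simp
  also have "\<dots> = 4 * fro A + fro B"
    unfolding Z_def using Ac by (subst fro_tall[OF _ AB(2)]) (auto simp: fro_double)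
  finally show ?thesis
    using 1 form_hor[OF AB(1,2)] form_lie[OF lie_uminus[OF AB(1)]] AB(3,4) by (simp add: fro_uminus)
qed

section \<open>A curve with different reduced and orthogonal lengths\<close>

text \<open>The test curve stays in the image of G_k under the base point, so that
  \<open>B = 0\<close> and the only difference left is the weight of the upper block. Its two
  explicit lifts also show that both metrics are defined on it.\<close>

lemma different_reduced_orthogonal:
  assumes J: "J \<in> lie k" "J \<noteq> (0\<^sub>m k k :: 'a mat)"
  shows "different_metrics (reduced_metric (k + q) k :: 'a curve_metric) (orthogonal_metric (k + q) k)"
proof -
  note Jc = lie_carrier[OF J(1)] and Jm = lie_uminus[OF J(1)]
  obtain u where u: "mat_deriv k k u (\<lambda>t. u t * J)" "\<And>t. t \<in> {0..1} \<Longrightarrow> u t \<in> grp k"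
    using grp_flow_exists[OF mat_cont_const[OF Jc] J(1)] by blast
  obtain s where s: "mat_deriv k k s (\<lambda>t. s t * - J)" "\<And>t. t \<in> {0..1} \<Longrightarrow> s t \<in> grp k"
    using grp_flow_exists[OF mat_cont_const[OF lie_carrier[OF Jm]] Jm] by blast
  \<comment> \<open>\<open>u\<close> and \<open>s\<close> run in opposite directions, so in
    \<open>u * adj s\<close> the two motions add up instead of cancelling.\<close>
  define w where "w t = u t * adj (s t)" for t
  \<comment> \<open>The velocity of \<open>w\<close> is twice \<open>u * J * adj s\<close>; pulling
    \<open>w\<close> out to the left conjugates \<open>J\<close> by \<open>s\<close>. No initial
    values of \<open>u\<close> and \<open>s\<close> are at hand, so the conjugation is kept and only
    the norm of \<open>W\<close> is computed.\<close>
  define W where "W t = s t * J * adj (s t) + s t * J * adj (s t)" for t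
  define m where "m t = base_point (k + q) k * w t" for t
  have dims [simp]: "dim_row (u t) = k" "dim_col (u t) = k" "dim_row (s t) = k" "dim_col (s t) = k"
    "adj (s t) * s t = 1\<^sub>m k" if "t \<in> {0..1}" for t
    using unitary_matsD[OF grp_unitary[OF u(2)[OF that]]] unitary_matsD[OF grp_unitary[OF s(2)[OF that]]]
    by auto
  note [simp] = carrier_matD[OF Jc]
  have w: "mat_deriv k k w (\<lambda>t. w t * W t)"
  proof (rule mat_deriv_cong[OF mat_deriv_mult[OF u(1) mat_deriv_adj[OF s(1)]]])
    fix t :: real
    assume t: "t \<in> {0..1}"
    have "adj (s t * - J) = J * adj (s t)"
      using t skew_matsD(2)[OF lie_skew[OF J(1)]] by (simp add: mat_dim_simps adj_uminus)
    then show "w t * W t = u t * adj (s t * - J) + u t * J * adj (s t)"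
      using t by (simp add: w_def W_def mat_dim_simps mat_mult_cancel_dim)
  qed (simp add: w_def)
  have w_grp: "w t \<in> grp k" and W_lie: "W t \<in> lie k" if "t \<in> {0..1}" for t
    unfolding w_def W_def using u(2)[OF that] s(2)[OF that] J(1)
    by (auto intro!: grp_mult grp_adj lie_add lie_conj)
  have W_cont: "mat_cont k k (\<lambda>t. W t)"
    unfolding W_def
    by (intro mat_cont_add mat_cont_mult[of _ k] mat_cont_adj mat_deriv_imp_cont[OF s(1)] mat_cont_const Jc)
  have w_cont: "mat_cont k k (\<lambda>t. w t * W t)"
    by (intro mat_cont_mult[of _ k] mat_deriv_imp_cont[OF w] W_cont)

  \<comment> \<open>Applied to \<open>w\<close> it gives the reduced lift, applied to
    \<open>u\<close> the first factor of the orthogonal lift.\<close>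
  have blk_vel: "has_velocity (k + q) (\<lambda>t. blk q (c t)) (\<lambda>t. blk q (c t) * hor q (C t) (0\<^sub>m k q))"
    if c: "mat_deriv k k c (\<lambda>t. c t * C t)" "mat_cont k k C" for c C :: "real \<Rightarrow> 'a mat"
  proof -
    have eq: "blk q (c t) * hor q (C t) (0\<^sub>m k q) = four_block_mat (c t * C t) (0\<^sub>m k q) (0\<^sub>m q k) (0\<^sub>m q q)"
      if t: "t \<in> {0..1}" for t
      unfolding hor_def using mat_derivD(1)[OF c(1) t] mat_contD[OF c(2) t]
      by (subst blk_mult_four_block[of _ k _ k _ q _ q]) auto
    show ?thesis
      unfolding has_velocity_iff
    proof
      show "mat_deriv (k + q) (k + q) (\<lambda>t. blk q (c t)) (\<lambda>t. blk q (c t) * hor q (C t) (0\<^sub>m k q))"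
        by (rule mat_deriv_cong[OF mat_deriv_blk[OF c(1)] _ eq]) simp
      have "mat_cont (k + q) (k + q)
          (\<lambda>t. four_block_mat (c t * C t) (0\<^sub>m k q :: 'a mat) (0\<^sub>m q k) (0\<^sub>m q q))"
        by (intro mat_cont_four_block mat_cont_mult[of _ k] mat_deriv_imp_cont[OF c(1)] c(2) mat_cont_const) auto
      then show "mat_cont (k + q) (k + q) (\<lambda>t. blk q (c t) * hor q (C t) (0\<^sub>m k q))"
        by (rule mat_cont_cong[OF _ eq])
    qed
  qed

  have stiefel: "\<forall>t\<in>{0..1}. m t \<in> stiefel (k + q) k"
  proof
    fix t :: real
    assume t: "t \<in> {0..1}"
    note U = unitary_matsD[OF grp_unitary[OF w_grp[OF t]]]
    have "base_point (k + q) k = four_block_mat (1\<^sub>m k :: 'a mat) (0\<^sub>m k 0) (0\<^sub>m q k) (0\<^sub>m q 0)"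
      by (rule base_point_four_block)
    then have "adj (base_point (k + q) k) * base_point (k + q) k = (1\<^sub>m k :: 'a mat)"
      using adj_base_point_mult[of "1\<^sub>m k :: 'a mat" k "0\<^sub>m q k" q] by simp
    then have "adj (m t) * m t = 1\<^sub>m k"
      unfolding m_def using U carrier_matD[OF U(1)] carrier_matD[OF base_point_carrier[of "k + q" k, where ?'a='a]]
      by (simp add: mat_dim_simps mat_mult_cancel_dim)
    moreover have "m t \<in> carrier_mat (k + q) k"
      unfolding m_def using U by (intro mult_carrier_mat[OF base_point_carrier]) auto
    ultimately show "m t \<in> stiefel (k + q) k"
      by (simp add: stiefel_def)
  qed

  have red: "horizontal (k + q) (reduced_p (k + q) k) (\<lambda>t. blk q (w t)) (\<lambda>t. hor q (W t) (0\<^sub>m k q))"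
    unfolding horizontal_def
  proof (intro conjI ballI blk_vel[OF w W_cont])
    fix t :: real
    assume "t \<in> {0..1}"
    then show "blk q (w t) \<in> grp (k + q)" "hor q (W t) (0\<^sub>m k q) \<in> reduced_p (k + q) k"
      using grp_blk[OF w_grp] W_lie zero_carrier_mat[of k q] unfolding reduced_p_iff by blast+
  qed
  have red_proj: "blk q (w t) * base_point (k + q) k = m t" if "t \<in> {0..1}" for t
    unfolding m_def by (rule blk_mult_base_point[OF grp_carrier[OF w_grp[OF that]]])

  have s_vel: "has_velocity k s (\<lambda>t. s t * - J)"
    unfolding has_velocity_iff
    using s(1) by (intro conjI mat_cont_mult[of _ k] mat_deriv_imp_cont[OF s(1)] mat_cont_const lie_carrier[OF Jm])
  have orth: "horizontal2 (k + q) k (orthogonal_p (k + q) k) (\<lambda>t. blk q (u t)) s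
      (\<lambda>t. hor q J (0\<^sub>m k q)) (\<lambda>t. - J)"
    unfolding horizontal2_def
  proof (intro conjI ballI blk_vel[OF u(1) mat_cont_const[OF Jc]] s_vel s(2))
    fix t :: real
    assume "t \<in> {0..1}"
    then show "blk q (u t) \<in> grp (k + q)" "(hor q J (0\<^sub>m k q), - J) \<in> orthogonal_p (k + q) k"
      using grp_blk[OF u(2)] J(1) zero_carrier_mat[of k q] unfolding orthogonal_p_iff by blast+
  qed
  have orth_proj: "blk q (u t) * base_point (k + q) k * adj (s t) = m t" if t: "t \<in> {0..1}" for t
    unfolding m_def w_def blk_mult_base_point[OF grp_carrier[OF u(2)[OF t]]]
    using t carrier_matD[OF base_point_carrier[of "k + q" k, where ?'a='a]]
    by (simp add: mat_mult_assoc_dim)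

  define m' where "m' t = blk q (w t) * hor q (W t) (0\<^sub>m k q) * base_point (k + q) k" for t
  have "mat_deriv (k + q) (k + q) (\<lambda>t. blk q (w t)) (\<lambda>t. blk q (w t) * hor q (W t) (0\<^sub>m k q))"
    using blk_vel[OF w W_cont] unfolding has_velocity_iff by blast
  from mat_deriv_mult_const[OF this base_point_carrier] have m': "mat_deriv (k + q) k m m'"
    by (rule mat_deriv_cong) (simp_all add: red_proj m'_def)
  have fro_W: "fro (W t) = 4 * fro J" if t: "t \<in> {0..1}" for t
    using fro_unitary_conj[OF grp_unitary[OF s(2)[OF t]] Jc] by (simp add: W_def fro_double)
  have red_form: "form (hor q (W t) (0\<^sub>m k q)) (hor q (W t) (0\<^sub>m k q)) = 2 * fro J"
    and orth_form: "form (hor q J (0\<^sub>m k q)) (hor q J (0\<^sub>m k q)) + form (- J) (- J) = fro J"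
    if t: "t \<in> {0..1}" for t
    using form_hor[OF W_lie[OF t] zero_carrier_mat[of k q]] form_hor[OF J(1) zero_carrier_mat[of k q]]
      form_lie[OF Jm] fro_W[OF t] by (simp_all add: fro_uminus)
  have reduced: "L = sqrt (2 * fro J)" if "L \<in> reduced_metric (k + q) k m" for L
  proof -
    obtain g X where g: "horizontal (k + q) (reduced_p (k + q) k) g X"
      "\<And>t. t \<in> {0..1} \<Longrightarrow> g t * base_point (k + q) k = m t" "L = sr_length X"
      using \<open>L \<in> reduced_metric (k + q) k m\<close> unfolding reduced_metric_def by auto
    \<comment> \<open>The speed formula is used for the arbitrary lift and for the explicit one.
      Their right-hand sides coincide, so the speed is known without evaluating the norms of
      \<open>m'\<close>. The orthogonal case is handled in the same way.\<close>
    have "form (X t) (X t) = 2 * fro J" if t: "t \<in> {0..1}" for t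
      using reduced_speed[OF g(1,2) m' t] reduced_speed[OF red red_proj m' t] red_form[OF t] by simp
    then have "sr_length X = integral {0..1} (\<lambda>t :: real. sqrt (2 * fro J))"
      unfolding sr_length_def by (intro integral_cong) simp
    then show ?thesis
      using g(3) by simp
  qed
  have orthogonal: "L = sqrt (fro J)" if "L \<in> orthogonal_metric (k + q) k m" for L
  proof -
    obtain r s' X Y where r: "horizontal2 (k + q) k (orthogonal_p (k + q) k) r s' X Y"
      "\<And>t. t \<in> {0..1} \<Longrightarrow> r t * base_point (k + q) k * adj (s' t) = m t" "L = sr_length2 X Y"
      using \<open>L \<in> orthogonal_metric (k + q) k m\<close> unfolding full_metric_def by auto
    have "form (X t) (X t) + form (Y t) (Y t) = fro J" if t: "t \<in> {0..1}" for t
      using orthogonal_speed[OF r(1,2) m' t] orthogonal_speed[OF orth orth_proj m' t] orth_form[OF t] by simp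
    then have "sr_length2 X Y = integral {0..1} (\<lambda>t :: real. sqrt (fro J))"
      unfolding sr_length2_def by (intro integral_cong) simp
    then show ?thesis
      using r(3) by simp
  qed
  have "fro J > 0"
    using fro_nonneg[of J] fro_eq_0_iff[OF Jc] J(2) by linarith
  then have "sqrt (2 * fro J) \<noteq> sqrt (fro J)"
    by simp
  then have "reduced_metric (k + q) k m \<inter> orthogonal_metric (k + q) k m = {}"
    using reduced orthogonal by blast
  moreover have "sr_length (\<lambda>t. hor q (W t) (0\<^sub>m k q)) \<in> reduced_metric (k + q) k m"
    unfolding reduced_metric_def using stiefel red red_proj by blast
  moreover have "sr_length2 (\<lambda>t. hor q J (0\<^sub>m k q)) (\<lambda>t. - J) \<in> orthogonal_metric (k + q) k m"
    unfolding full_metric_def using stiefel orth orth_proj by blast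
  ultimately show ?thesis
    unfolding different_metrics_def by blast
qed

end

section \<open>The real, complex and quaternionic cases\<close>

lemma unitary_mats_mult:
  assumes "g \<in> unitary_mats n" "h \<in> unitary_mats n"
  shows "(g :: 'a :: star_ring mat) * h \<in> unitary_mats n"
proof -
  have [simp]: "dim_row g = n" "dim_col g = n" "dim_row h = n" "dim_col h = n"
    "adj g * g = 1\<^sub>m n" "g * adj g = 1\<^sub>m n" "adj h * h = 1\<^sub>m n" "h * adj h = 1\<^sub>m n"
    using assms unfolding unitary_mats_def by blast+
  show ?thesis
    unfolding unitary_mats_def
    by (intro CollectI conjI carrier_matI) (simp_all add: mat_dim_simps mat_mult_cancel_dim)
qed

lemma unitary_mats_adj: "g \<in> unitary_mats n \<Longrightarrow> adj g \<in> unitary_mats n"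
  by (auto simp: unitary_mats_def)

lemma skew_mats_zero: "(0\<^sub>m n n :: 'a :: star_ring mat) \<in> skew_mats n"
  by (simp add: skew_mats_def)

lemma skew_mats_add:
  assumes "(X :: 'a :: star_ring mat) \<in> skew_mats n" "Y \<in> skew_mats n"
  shows "X + Y \<in> skew_mats n"
proof -
  have X: "X \<in> carrier_mat n n" "adj X = - X" and Y: "Y \<in> carrier_mat n n" "adj Y = - Y"
    using assms by (auto simp: skew_mats_def)
  have "adj (X + Y) = - X + - Y"
    using X Y by (simp add: adj_add[of _ n n])
  also have "\<dots> = - (X + Y)"
    using X(1) Y(1) by (intro eq_matI) auto
  finally show ?thesis
    using X(1) Y(1) by (simp add: skew_mats_def)
qed

lemma skew_mats_uminus: "(X :: 'a :: star_ring mat) \<in> skew_mats n \<Longrightarrow> - X \<in> skew_mats n"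
  by (simp add: skew_mats_def adj_uminus)

lemma skew_mats_conj:
  assumes "(X :: 'a :: star_ring mat) \<in> skew_mats n" "g \<in> unitary_mats n"
  shows "g * X * adj g \<in> skew_mats n"
proof -
  have [simp]: "dim_row g = n" "dim_col g = n" "dim_row X = n" "dim_col X = n" "adj X = - X"
    using assms unfolding unitary_mats_def skew_mats_def by blast+
  show ?thesis
    unfolding skew_mats_def
    by (intro CollectI conjI carrier_matI) (simp_all add: mat_dim_simps)
qed

lemma tr_add: "A \<in> carrier_mat n n \<Longrightarrow> B \<in> carrier_mat n n \<Longrightarrow> tr (A + B) = tr A + tr B"
  by (simp add: tr_def sum.distrib)

lemma tr_uminus: "A \<in> carrier_mat n n \<Longrightarrow> tr (- A :: 'a :: ab_group_add mat) = - tr A"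
  by (simp add: tr_def flip: sum_negf)

lemma tr_mult_commute:
  fixes A B :: "'a :: comm_ring_1 mat"
  assumes "A \<in> carrier_mat n m" "B \<in> carrier_mat m n"
  shows "tr (A * B) = tr (B * A)"
proof -
  have "tr (A * B) = (\<Sum>i<n. \<Sum>j<m. A $$ (i, j) * B $$ (j, i))"
    using assms by (simp add: tr_def index_mult_mat_sum[OF assms] del: index_mult_mat(1))
  also have "\<dots> = (\<Sum>j<m. \<Sum>i<n. B $$ (j, i) * A $$ (i, j))"
    by (subst sum.swap) (simp only: mult.commute)
  also have "\<dots> = tr (B * A)"
    using assms by (simp add: tr_def index_mult_mat_sum[OF assms(2,1)] del: index_mult_mat(1))
  finally show ?thesis .
qed

lemma tr_unitary_conj:
  fixes g X :: "'a :: {comm_ring_1, star_ring} mat"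
  assumes g: "g \<in> unitary_mats n" and X: "X \<in> carrier_mat n n"
  shows "tr (g * X * adj g) = tr X"
proof -
  have G: "g \<in> carrier_mat n n" "adj g * g = 1\<^sub>m n"
    using g by (auto simp: unitary_mats_def)
  have "tr (g * X * adj g) = tr (adj g * (g * X))"
    by (rule tr_mult_commute[OF mult_carrier_mat[OF G(1) X] adj_carrier[OF G(1)]])
  also have "adj g * (g * X) = X"
    using G carrier_matD[OF G(1)] carrier_matD[OF X] by (simp add: mat_mult_cancel_dim)
  finally show ?thesis .
qed

lemma det_adj_unitary:
  fixes g :: "'a :: {comm_ring_1, star_ring} mat"
  assumes "g \<in> unitary_mats n" "det g = 1"
  shows "det (adj g) = 1"
proof -
  have G: "g \<in> carrier_mat n n" "adj g * g = 1\<^sub>m n"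
    using assms(1) by (auto simp: unitary_mats_def)
  show ?thesis
    using det_mult[OF adj_carrier[OF G(1)] G(1)] G(2) assms(2) by simp
qed

text \<open>Transposition preserves the trace and skewness negates it. This supplies the trace
  condition of \<open>det_flow_eq_one\<close>, which for real matrices is not part of
  \<open>lie\<close>.\<close>

lemma tr_real_skew:
  assumes "X \<in> skew_mats n"
  shows "tr (X :: real mat) = 0"
proof -
  have X: "X \<in> carrier_mat n n" "adj X = - X"
    using assms by (auto simp: skew_mats_def)
  have "tr (adj X) = tr X"
    using X(1) by (simp add: tr_def star_real_def)
  then show ?thesis
    using X tr_uminus[OF X(1)] by simp
qed

interpretation real_case: classical "\<lambda>x :: real. x"
proof
  fix u Z :: "real \<Rightarrow> real mat" and n and t :: real
  assume *: "mat_deriv n n u (\<lambda>t. u t * Z t)" "u 0 = 1\<^sub>m n" "\<And>t. t \<in> {0..1} \<Longrightarrow> Z t \<in> lie n"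
    "\<And>t. t \<in> {0..1} \<Longrightarrow> u t \<in> unitary_mats n" and t: "t \<in> {0..1}"
  have "Z t \<in> carrier_mat n n" "tr (Z t) = 0" if "t \<in> {0..1}" for t
    using *(3)[OF that] by (simp_all add: lie_real_def skew_matsD(1) tr_real_skew[of _ n])
  then have "det (u t) = 1"
    by (rule det_flow_eq_one[OF *(1,2) _ _ *(4) t])
  then show "u t \<in> grp n"
    using *(4)[OF t] by (simp add: grp_real_def)
next
  show "g * h \<in> grp n" if "g \<in> grp n" "h \<in> grp n" for g h :: "real mat" and n
    using that by (simp add: grp_real_def unitary_mats_mult det_mult[of _ n] unitary_matsD(1))
  show "adj g \<in> grp n" if "g \<in> grp n" for g :: "real mat" and n
    using that det_adj_unitary[of g n] by (simp add: grp_real_def unitary_mats_adj)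
  show "blk q g \<in> grp (n + q)" if "g \<in> grp n" for g :: "real mat" and n q
    using that by (simp add: grp_real_def blk_unitary det_blk[of _ n] unitary_matsD(1))
qed (simp_all add: star_real_def grp_real_def lie_real_def form_real_def power2_eq_square
    skew_mats_add skew_mats_uminus skew_mats_conj skew_mats_zero)

interpretation complex_case: classical Re
proof
  fix u Z :: "real \<Rightarrow> complex mat" and n and t :: real
  assume *: "mat_deriv n n u (\<lambda>t. u t * Z t)" "u 0 = 1\<^sub>m n" "\<And>t. t \<in> {0..1} \<Longrightarrow> Z t \<in> lie n"
    "\<And>t. t \<in> {0..1} \<Longrightarrow> u t \<in> unitary_mats n" and t: "t \<in> {0..1}"
  have "Z t \<in> carrier_mat n n" "tr (Z t) = 0" if "t \<in> {0..1}" for t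
    using *(3)[OF that] by (simp_all add: lie_complex_def skew_matsD(1))
  then have "det (u t) = 1"
    by (rule det_flow_eq_one[OF *(1,2) _ _ *(4) t])
  then show "u t \<in> grp n"
    using *(4)[OF t] by (simp add: grp_complex_def)
next
  show "g * h \<in> grp n" if "g \<in> grp n" "h \<in> grp n" for g h :: "complex mat" and n
    using that by (simp add: grp_complex_def unitary_mats_mult det_mult[of _ n] unitary_matsD(1))
  show "adj g \<in> grp n" if "g \<in> grp n" for g :: "complex mat" and n
    using that det_adj_unitary[of g n] by (simp add: grp_complex_def unitary_mats_adj)
  show "blk q g \<in> grp (n + q)" if "g \<in> grp n" for g :: "complex mat" and n q
    using that by (simp add: grp_complex_def blk_unitary det_blk[of _ n] unitary_matsD(1))
  show "X + Y \<in> lie n" if "X \<in> lie n" "Y \<in> lie n" for X Y :: "complex mat" and n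
    using that by (simp add: lie_complex_def skew_mats_add tr_add[of _ n] skew_matsD(1))
  show "- X \<in> lie n" if "X \<in> lie n" for X :: "complex mat" and n
    using that by (simp add: lie_complex_def skew_mats_uminus tr_uminus[of _ n] skew_matsD(1))
  show "g * X * adj g \<in> lie n" if "X \<in> lie n" "g \<in> grp n" for g X :: "complex mat" and n
    using that
    by (simp add: lie_complex_def grp_complex_def skew_mats_conj tr_unitary_conj[of _ n] skew_matsD(1))
  show "(0\<^sub>m n n :: complex mat) \<in> lie n" for n
    by (simp add: lie_complex_def skew_mats_zero tr_def)
  show "Re (x * y) = Re (y * x)" for x y
    by (simp only: mult.commute)
  show "Re (star x * x) = (cmod x)\<^sup>2" for x
    unfolding star_complex_def cmod_power2 by (simp add: power2_eq_square)
  show "form A A = - Re (tr (A * A)) / 2" for A :: "complex mat"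
    by (simp add: form_complex_def)
qed (simp_all add: star_complex_def grp_complex_def lie_complex_def)

lemma qre_sum: "qre (sum f S) = (\<Sum>x\<in>S. qre (f x))"
  by (induction S rule: infinite_finite_induct) simp_all

interpretation quat_case: classical qre
proof
  show "qre (x * y) = qre (y * x)" for x y
    by (simp add: times_quat_def mult.commute)
  show "qre (star x * x) = (norm x)\<^sup>2" for x
    by (simp add: star_quat_def times_quat_def norm_quat_sqrt power2_eq_square)
  show "star (c *\<^sub>R x) = c *\<^sub>R star x" for c and x :: quat
    by (simp add: star_quat_def scaleR_quat_def)
  show "norm (star x) = norm x" for x :: quat
    by (simp add: star_quat_def norm_quat_sqrt)
  \<comment> \<open>A quaternion and its conjugate have equal real parts, so adding the adjoint
    doubles the real trace and turns the factor 1/4 into 1/2.\<close>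
  show "form A A = - qre (tr (A * A)) / 2" if "A \<in> skew_mats n" for A n
    using skew_matsD(1)[OF that]
    by (simp add: form_quat_def tr_def qre_sum sum.distrib star_quat_def)
qed (simp_all add: grp_quat_def lie_quat_def unitary_mats_mult unitary_mats_adj skew_mats_add
    skew_mats_uminus skew_mats_conj skew_mats_zero blk_unitary)

section \<open>Nonzero elements of the Lie algebras\<close>

text \<open>The generator of rotations in the first two coordinates. Its entries are fixed by
  \<open>star\<close> and its diagonal is zero, so it lies in so(k) and in su(k) alike.\<close>

lemma skew_mats_nonzero:
  assumes "2 \<le> k"
  obtains J :: "'a :: star_ring mat" where "J \<in> skew_mats k" "tr J = 0" "J \<noteq> 0\<^sub>m k k"
proof -
  define J :: "'a mat" where
    "J = mat k k (\<lambda>(i, j). if i = 0 \<and> j = 1 then 1 else if i = 1 \<and> j = 0 then - 1 else 0)"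
  have 1: "J \<in> skew_mats k"
    unfolding skew_mats_def
  proof (intro CollectI conjI)
    show "adj J = - J"
      by (rule eq_matI) (auto simp: J_def star_uminus)
  qed (simp add: J_def)
  have 2: "tr J = 0"
    unfolding tr_def by (rule sum.neutral) (auto simp: J_def)
  have "J $$ (0, 1) \<noteq> (0\<^sub>m k k :: 'a mat) $$ (0, 1)"
    using assms by (simp add: J_def)
  then have "J \<noteq> 0\<^sub>m k k"
    by metis
  with 1 2 show thesis
    by (rule that)
qed

text \<open>An imaginary unit in one corner is skew by itself, so a single coordinate
  suffices.\<close>

lemma quat_skew_mats_nonzero:
  assumes "1 \<le> k"
  obtains J :: "quat mat" where "J \<in> skew_mats k" "J \<noteq> 0\<^sub>m k k"
proof -
  define J where "J = mat k k (\<lambda>(i, j). if i = 0 \<and> j = 0 then Quat 0 1 0 0 else 0)"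
  have 1: "J \<in> skew_mats k"
    unfolding skew_mats_def
  proof (intro CollectI conjI)
    show "adj J = - J"
      by (rule eq_matI) (auto simp: J_def star_quat_def uminus_quat_def zero_quat_def)
  qed (simp add: J_def)
  have "J $$ (0, 0) \<noteq> (0\<^sub>m k k :: quat mat) $$ (0, 0)"
    using assms by (simp add: J_def zero_quat_def)
  then have "J \<noteq> 0\<^sub>m k k"
    by metis
  with 1 show thesis
    by (rule that)
qed

theorem theorem2:
  fixes n k :: nat
  assumes "1 \<le> k" and "k \<le> n"
  shows
    "((reduced_metric n k :: real curve_metric) = quasi_geodesic_metric n k \<and>
      (2 \<le> k \<longrightarrow>
        different_metrics (reduced_metric n k :: real curve_metric) (orthogonal_metric n k) \<and>
        different_metrics (quasi_geodesic_metric n k :: real curve_metric) (orthogonal_metric n k))) \<and>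
     ((reduced_metric n k :: complex curve_metric) = quasi_geodesic_metric n k \<and>
      (2 \<le> k \<longrightarrow>
        different_metrics (reduced_metric n k :: complex curve_metric) (orthogonal_metric n k) \<and>
        different_metrics (quasi_geodesic_metric n k :: complex curve_metric) (orthogonal_metric n k))) \<and>
     ((reduced_metric n k :: quat curve_metric) = quasi_geodesic_metric n k \<and>
      different_metrics (reduced_metric n k :: quat curve_metric) (orthogonal_metric n k) \<and>
      different_metrics (quasi_geodesic_metric n k :: quat curve_metric) (orthogonal_metric n k))"
proof -
  obtain q where n: "n = k + q"
    using \<open>k \<le> n\<close> le_Suc_ex by blast
  have "different_metrics (reduced_metric n k :: real curve_metric) (orthogonal_metric n k)" if k: "2 \<le> k"
  proof -
    obtain J :: "real mat" where "J \<in> skew_mats k" "tr J = 0" "J \<noteq> 0\<^sub>m k k"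
      using skew_mats_nonzero[OF k] .
    then show ?thesis
      unfolding n by (intro real_case.different_reduced_orthogonal[of J]) (simp_all add: lie_real_def)
  qed
  moreover have "different_metrics (reduced_metric n k :: complex curve_metric) (orthogonal_metric n k)"
    if k: "2 \<le> k"
  proof -
    obtain J :: "complex mat" where "J \<in> skew_mats k" "tr J = 0" "J \<noteq> 0\<^sub>m k k"
      using skew_mats_nonzero[OF k] .
    then show ?thesis
      unfolding n by (intro complex_case.different_reduced_orthogonal[of J]) (simp_all add: lie_complex_def)
  qed
  moreover have "different_metrics (reduced_metric n k :: quat curve_metric) (orthogonal_metric n k)"
  proof -
    obtain J :: "quat mat" where "J \<in> skew_mats k" "J \<noteq> 0\<^sub>m k k"
      using quat_skew_mats_nonzero[OF \<open>1 \<le> k\<close>] .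
    then show ?thesis
      unfolding n by (intro quat_case.different_reduced_orthogonal[of J]) (simp_all add: lie_quat_def)
  qed
  \<comment> \<open>Rewriting the reduced metric into the quasi-geodesic one, in the facts as well
    as in the goal, makes the equalities trivial and merges the two difference claims of each case
    into one.\<close>
  ultimately show ?thesis
    unfolding n real_case.reduced_metric_eq_quasi_geodesic_metric
      complex_case.reduced_metric_eq_quasi_geodesic_metric
      quat_case.reduced_metric_eq_quasi_geodesic_metric
    by blast
qed

end
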